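(* Let $d,k$ be positive integers, let $F:\mathbb{I}^d\to[k]$ be a measurable function, and let $\epsilon>0$. Then there exist a positive integer $l$ (which may depend on $F$ and $\epsilon$) and an $l$-part homogeneous function $G:\mathbb{I}^d\to[k]$ such that $d(F,G)\leq\epsilon$. Moreover, every function $R:[n]^d\to[k]$, for any natural number $n$, that appears in $G$ already appears with positive probability in $F$.
   Context: $\mathbb{I}=\{x\in\mathbb{R}:0<x\leq 1\}$ and $[k]=\{1,\ldots,k\}$. A function $F:\mathbb{I}^d\to[k]$ is measurable if every preimage $F^{-1}(i)$ is Lebesgue measurable. For measurable $F,G:\mathbb{I}^d\to[k]$, $d(F,G)=\Pr[F(x_1,\ldots,x_d)\neq G(x_1,\ldots,x_d)]$ for $(x_1,\ldots,x_d)$ uniform in $\mathbb{I}^d$ (the Lebesgue measure of the set where they differ). A function $G:\mathbb{I}^d\to[k]$ is $l$-part homogeneous if $G(x_1,\ldots,x_d)$ depends only on $\lceil lx_1\rceil,\ldots,\lceil lx_d\rceil$ and on the order of $x_1,\ldots,x_d$ (i.e. on whether $x_j\leq x_{j'}$ and/or $x_j\geq x_{j'}$ for all $1\le j<j'\le d$). For $R:[n]^d\to[k]$, $R$ appears in $F$ if there exist $0<x_1<\cdots<x_n\leq1$ with $F(x_{i_1},\ldots,x_{i_d})=R(i_1,\ldots,i_d)$ for all $(i_1,\ldots,i_d)\in[n]^d$. The $[n]^d$-statistic distribution $\mu_{F,n}$ is the distribution of the function $(i_1,\ldots,i_d)\mapsto F(x_{i_1},\ldots,x_{i_d})$ on $[n]^d$,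 where $0<x_1<\cdots<x_n\le 1$ is chosen uniformly at random (e.g. as the sorted values of $n$ independent uniform points of $\mathbb{I}$). $R$ appears in $F$ with positive probability if $\mu_{F,n}(R)>0$.
   Formalization: The event that R appears in F involves values of F on diagonals, where a Lebesgue measurable F is arbitrary, so its probability may be undefined; "positive probability" is taken as positive outer measure, which equals the probability whenever the event is measurable. *)

theory Defs
  imports "HOL-Analysis.Analysis"
begin

text \<open>
  The dimension \<open>d\<close> is the cardinality of the finite index type \<open>'d\<close>. The number \<open>n\<close> of sample
  points is an ordinary natural number, and sample points \<open>x\<^sub>1, \<dots>, x\<^sub>n\<close> are extensional functions
  on \<open>{1..n}\<close>.
\<close>

definition unit_cube :: "(real ^ 'd) set" where
  "unit_cube = {x. \<forall>j. x $ j \<in> {0<..1}}"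

definition grid :: "nat \<Rightarrow> (nat ^ 'd) set" where
  "grid n = {i. \<forall>j. i $ j \<in> {1..n}}"

definition measurable_colouring :: "nat \<Rightarrow> (real ^ 'd \<Rightarrow> nat) \<Rightarrow> bool" where
  "measurable_colouring k F \<longleftrightarrow>
     F \<in> unit_cube \<rightarrow> {1..k} \<and> (\<forall>c\<in>{1..k}. {x \<in> unit_cube. F x = c} \<in> sets lebesgue)"

definition colouring_dist :: "(real ^ 'd \<Rightarrow> nat) \<Rightarrow> (real ^ 'd \<Rightarrow> nat) \<Rightarrow> real" where
  "colouring_dist F G = measure lebesgue {x \<in> unit_cube. F x \<noteq> G x}"

definition part_homogeneous :: "nat \<Rightarrow> (real ^ 'd \<Rightarrow> nat) \<Rightarrow> bool" where
  "part_homogeneous l G \<longleftrightarrow>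
     (\<forall>x\<in>unit_cube. \<forall>y\<in>unit_cube.
        (\<forall>j. \<lceil>real l * x $ j\<rceil> = \<lceil>real l * y $ j\<rceil>) \<and>
        (\<forall>j j'. x $ j \<le> x $ j' \<longleftrightarrow> y $ j \<le> y $ j')
        \<longrightarrow> G x = G y)"

definition ordered_points :: "nat \<Rightarrow> (nat \<Rightarrow> real) set" where
  "ordered_points n = {x \<in> {1..n} \<rightarrow>\<^sub>E {0<..1}. strict_mono_on {1..n} x}"

definition realizes :: "(real ^ 'd \<Rightarrow> nat) \<Rightarrow> nat \<Rightarrow> (nat ^ 'd \<Rightarrow> nat) \<Rightarrow> (nat \<Rightarrow> real) \<Rightarrow> bool" where
  "realizes F n R x \<longleftrightarrow> (\<forall>i\<in>grid n. F (\<chi> j. x (i $ j)) = R i)"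

definition appears_in :: "nat \<Rightarrow> (nat ^ 'd \<Rightarrow> nat) \<Rightarrow> (real ^ 'd \<Rightarrow> nat) \<Rightarrow> bool" where
  "appears_in n R F \<longleftrightarrow> (\<exists>x\<in>ordered_points n. realizes F n R x)"

definition uniform_ordered_points :: "nat \<Rightarrow> (nat \<Rightarrow> real) measure" where
  "uniform_ordered_points n = uniform_measure (PiM {1..n} (\<lambda>_. lborel)) (ordered_points n)"

text \<open>
  The probability of \<open>R\<close> under the \<open>[n]\<^sup>d\<close>-statistic distribution of \<open>F\<close>. Index tuples in
  \<open>[n]\<^sup>d\<close> may have repeated entries, so the event involves the values of \<open>F\<close> on diagonals. These are
  null sets, on which a Lebesgue measurable \<open>F\<close> is arbitrary; the event may then fail to be
  measurable, and the library's measure would assign it the junk value 0. The outer measure agrees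
  with the measure on every (Borel or Lebesgue) measurable event and is positive exactly when the
  event is not a null set.
\<close>

definition statistic_prob :: "(real ^ 'd \<Rightarrow> nat) \<Rightarrow> nat \<Rightarrow> (nat ^ 'd \<Rightarrow> nat) \<Rightarrow> ennreal" where
  "statistic_prob F n R =
     outer_measure_of (uniform_ordered_points n) {x \<in> ordered_points n. realizes F n R x}"

definition appears_with_positive_prob ::
    "nat \<Rightarrow> (nat ^ 'd \<Rightarrow> nat) \<Rightarrow> (real ^ 'd \<Rightarrow> nat) \<Rightarrow> bool" where
  "appears_with_positive_prob n R F \<longleftrightarrow> statistic_prob F n R > 0"

lemma ordered_points_measurable: "ordered_points n \<in> sets (PiM {1..n} (\<lambda>_. lborel))"
proof -
  have "ordered_points n = {x \<in> space (PiM {1..n} (\<lambda>_. lborel)).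
      (\<forall>i\<in>{1..n}. 0 < x i \<and> x i \<le> 1) \<and> (\<forall>i\<in>{1..n}. \<forall>j\<in>{1..n}. i < j \<longrightarrow> x i < x j)}"
    by (auto simp: ordered_points_def space_PiM PiE_iff strict_mono_on_def)
  also have "\<dots> \<in> sets (PiM {1..n} (\<lambda>_. lborel))"
    by measurable
  finally show ?thesis .
qed

lemma statistic_prob_eq_completion:
  assumes "{x \<in> ordered_points n. realizes F n R x} \<in> sets (completion (uniform_ordered_points n))"
  shows "statistic_prob F n R =
    emeasure (completion (uniform_ordered_points n)) {x \<in> ordered_points n. realizes F n R x}"
proof -
  let ?M = "uniform_ordered_points n" and ?A = "{x \<in> ordered_points n. realizes F n R x}"
  obtain S N N' where S: "?A = S \<union> N" "N \<subseteq> N'" "N' \<in> null_sets ?M" "S \<in> sets ?M"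
    using assms unfolding sets_completion by blast
  have "outer_measure_of ?M ?A \<le> emeasure ?M (S \<union> N')"
    unfolding outer_measure_of_def using S by (intro INF_lower) auto
  also have "\<dots> = emeasure ?M S"
    using S by (simp add: emeasure_Un_null_set)
  also have "\<dots> = emeasure (completion ?M) S"
    using S by simp
  also have "\<dots> \<le> emeasure (completion ?M) ?A"
    using S assms by (intro emeasure_mono) auto
  finally have le: "outer_measure_of ?M ?A \<le> emeasure (completion ?M) ?A" .
  have "emeasure (completion ?M) ?A \<le> emeasure ?M B" if "B \<in> sets ?M" "?A \<subseteq> B" for B
    using that emeasure_mono[of ?A B "completion ?M"] by simp
  then have "emeasure (completion ?M) ?A \<le> outer_measure_of ?M ?A"
    unfolding outer_measure_of_def by (intro INF_greatest) auto
  with le show ?thesis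
    by (simp add: statistic_prob_def)
qed

end

theory Submission
  imports Defs "HOL-Library.Ramsey"
begin

text \<open>
  Cut \<open>(0, 1]\<close> into \<open>l\<close> parts and choose one random point \<open>z\<^sub>s\<close> in each part \<open>s\<close>. Outside a set of
  measure at most \<open>\<eta>\<close> the colouring \<open>F\<close> agrees with a locally constant one on a compact set that avoids
  the diagonals, so for large \<open>l\<close> and a set of \<open>z\<close> of positive measure, giving the cell with
  (pairwise distinct) parts \<open>i\<^sub>1, \<dots>, i\<^sub>d\<close> the colour \<open>F(z\<^sub>i\<^sub>1, \<dots>, z\<^sub>i\<^sub>d)\<close> approximates \<open>F\<close>. By pigeonhole
  a single such assignment \<open>C\<close> of colours arises from a set \<open>E\<close> of positive measure.

  By Fubini, applied to one coordinate at a time, \<open>N\<close> points can be put into every part so that, with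
  positive probability, all transversals lie in \<open>E\<close>. Ramsey's theorem then selects points on which
  \<open>F\<close> depends only on the parts and on the order type, also for tuples with several
  entries in one part or with repeated entries, where \<open>F\<close> need not be measurable. The resulting
  pattern agrees with \<open>C\<close> on the cells with distinct parts and defines a homogeneous \<open>G\<close>.

  There are only finitely many patterns. If each of them contained some \<open>R\<close> whose occurrences in \<open>F\<close>
  form a null set, then the sampled points would almost surely avoid the preimages of
  these finitely many null sets, contradicting the previous step.
\<close>

section \<open>Ramsey theorem for order types\<close>

text \<open>A canonical code for the weak order of a tuple: equal entries share a rank, and the
  ranks used are consecutive from \<open>0\<close>. Order types of tuples over different linear
  orders can thus be compared, and only finitely many codes occur.\<close>

definition dense_rank :: "('d \<Rightarrow> 'a::linorder) \<Rightarrow> 'd \<Rightarrow> nat" where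
  "dense_rank t j = card {a \<in> range t. a < t j}"

lemma dense_rank_less_CARD: "dense_rank t j < CARD('d)" for t :: "'d::finite \<Rightarrow> 'a::linorder"
proof -
  have "{a \<in> range t. a < t j} \<subset> range t"
    by auto
  then have "dense_rank t j < card (range t)"
    unfolding dense_rank_def by (intro psubset_card_mono) auto
  also have "\<dots> \<le> CARD('d)"
    by (rule card_image_le) simp
  finally show ?thesis .
qed

text \<open>The assignment \<open>t j \<mapsto> u j\<close> is a well-defined order isomorphism
  between the two ranges, so it matches the values below \<open>t j\<close> with those below
  \<open>u j\<close>.\<close>

lemma dense_rank_cong:
  fixes t :: "'d \<Rightarrow> 'a::linorder" and u :: "'d \<Rightarrow> 'b::linorder"
  assumes "\<And>j j'. t j \<le> t j' \<longleftrightarrow> u j \<le> u j'"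
  shows "dense_rank t = dense_rank u"
proof
  fix j
  define f where "f a = u (SOME j. t j = a)" for a
  have f: "f (t i) = u i" for i
  proof -
    have "t (SOME j. t j = t i) = t i"
      by (rule someI) simp
    then show ?thesis
      unfolding f_def using assms[of i "SOME j. t j = t i"] assms[of "SOME j. t j = t i" i]
      by (simp add: antisym)
  qed
  have less: "t i < t i' \<longleftrightarrow> u i < u i'" for i i'
    using assms[of i' i] by (auto simp: not_le[symmetric])
  have "inj_on f (range t)"
    using assms f by (intro inj_onI) (auto, metis antisym order_refl)
  moreover have "f ` {a \<in> range t. a < t j} = {b \<in> range u. b < u j}"
    using f less by (force simp: image_iff)
  ultimately have "bij_betw f {a \<in> range t. a < t j} {b \<in> range u. b < u j}"
    unfolding bij_betw_def by (auto intro: inj_on_subset)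
  then show "dense_rank t j = dense_rank u j"
    unfolding dense_rank_def by (rule bij_betw_same_card)
qed

lemma strict_mono_on_card_less:
  fixes e :: "nat \<Rightarrow> 'a::linorder"
  assumes "strict_mono_on {..<m} e" "i < m"
  shows "card {s \<in> e ` {..<m}. s < e i} = i"
proof -
  have "{s \<in> e ` {..<m}. s < e i} = e ` {..<i}"
  proof -
    have "e a < e i \<longleftrightarrow> a < i" if "a < m" for a
      using strict_mono_on_less[OF assms(1)] that assms(2) by simp
    then show ?thesis
      using assms(2) by auto
  qed
  moreover have "inj_on e {..<i}"
    using strict_mono_on_imp_inj_on[OF assms(1)] assms(2) by (auto intro: inj_on_subset)
  ultimately show ?thesis
    by (simp add: card_image)
qed

text \<open>Colour each \<open>CARD('d)\<close>-subset \<open>S\<close> by the whole table of values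
  of \<open>\<Phi>\<close> on tuples from \<open>S\<close>, indexed by rank vectors. On a
  homogeneous set all tables agree, and a tuple with fewer distinct entries, padded to a full subset
  by larger elements, reads its value off the same table at its order type.\<close>

theorem order_type_ramsey:
  fixes K :: "'c set" and n :: nat
  assumes "finite K"
  obtains N where "\<And>\<Phi> :: ('d::finite \<Rightarrow> nat) \<Rightarrow> 'c. (\<And>a. (\<forall>j. a j < N) \<Longrightarrow> \<Phi> a \<in> K) \<Longrightarrow>
    \<exists>h P. strict_mono_on {..n} h \<and> h ` {..n} \<subseteq> {..<N} \<and>
      (\<forall>\<rho>. (\<forall>j. \<rho> j < CARD('d)) \<longrightarrow> P \<rho> \<in> K) \<and>
      (\<forall>t. (\<forall>j. t j \<le> n) \<longrightarrow> \<Phi> (h \<circ> t) = P (dense_rank t))"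
proof -
  let ?d = "CARD('d)"
  define D where "D = {\<rho> :: 'd \<Rightarrow> nat. \<forall>j. \<rho> j < ?d}"
  have finD: "finite D"
  proof -
    have "D = UNIV \<rightarrow>\<^sub>E {..<?d}"
      by (auto simp: D_def PiE_def extensional_def)
    then show ?thesis
      by (simp add: finite_PiE)
  qed
  define KK where "KK = D \<rightarrow>\<^sub>E K"
  have "finite KK"
    unfolding KK_def using finD assms by (intro finite_PiE) auto
  then obtain q :: nat and enc where enc: "bij_betw enc KK {..<q}"
    by (metis ex_bij_betw_finite_nat atLeast0LessThan)
  \<comment> \<open>Of the \<open>n + 1 + CARD('d)\<close> homogeneous elements, the first
    \<open>n + 1\<close> carry the tuples and the last \<open>CARD('d)\<close> serve as
    padding.\<close>
  obtain N :: nat where N: "partn_lst {..<N} (replicate q (n + 1 + ?d)) ?d"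
    using ramsey_full by blast
  show thesis
  proof (rule that[of N])
    fix \<Phi> :: "('d \<Rightarrow> nat) \<Rightarrow> 'c"
    assume \<Phi>: "\<And>a. (\<forall>j. a j < N) \<Longrightarrow> \<Phi> a \<in> K"
    have "\<forall>S::nat set. \<exists>e. finite S \<longrightarrow> bij_betw e {..<card S} S \<and> strict_mono_on {..<card S} e"
      using ex_bij_betw_strict_mono_card by metis
    then obtain e :: "nat set \<Rightarrow> nat \<Rightarrow> nat" where
      e: "\<And>S. finite S \<Longrightarrow> bij_betw (e S) {..<card S} S"
         "\<And>S. finite S \<Longrightarrow> strict_mono_on {..<card S} (e S)"
      by metis
    define col where "col S = (\<lambda>\<rho>\<in>D. \<Phi> (e S \<circ> \<rho>))" for S
    have col: "col S \<in> KK" if "S \<in> nsets {..<N} ?d" for S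
    proof -
      have "finite S" "S \<subseteq> {..<N}" "card S = ?d"
        using that by (auto simp: nsets_def)
      then have "e S i < N" if "i < ?d" for i
        using e(1)[of S] that by (auto simp: bij_betw_def)
      then show ?thesis
        by (auto simp: col_def KK_def D_def intro!: \<Phi>)
    qed
    then have "enc \<circ> col \<in> nsets {..<N} ?d \<rightarrow> {..<q}"
      using enc by (auto simp: bij_betw_def)
    then obtain i H where iH: "i < q" "H \<in> nsets {..<N} (n + 1 + ?d)"
      "(enc \<circ> col) ` nsets H ?d \<subseteq> {i}"
      using N unfolding partn_lst_def monochromatic_def by force
    then have H: "finite H" "H \<subseteq> {..<N}" "card H = n + 1 + ?d"
      by (auto simp: nsets_def)
    obtain P where P: "\<And>S. S \<in> nsets H ?d \<Longrightarrow> col S = P" "P \<in> KK"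
    proof -
      have "?d \<le> card H" using H by simp
      then obtain S0 where "S0 \<subseteq> H" "card S0 = ?d" "finite S0"
        using obtain_subset_with_card_n by blast
      then have S0: "S0 \<in> nsets H ?d"
        by (simp add: nsets_def)
      have sub: "nsets H ?d \<subseteq> nsets {..<N} ?d"
        using H(2) by (auto simp: nsets_def)
      have "col S = col S0" if "S \<in> nsets H ?d" for S
        using iH(3) that S0 sub enc col
        by (intro inj_onD[OF bij_betw_imp_inj_on[OF enc]]) auto
      then show thesis
        using that S0 sub col by blast
    qed
    define h where "h = e H"
    have h: "strict_mono_on {..<n + 1 + ?d} h" "h ` {..<n + 1 + ?d} = H"
      using e[OF H(1)] H(3) by (auto simp: h_def bij_betw_def)
    have "\<Phi> (h \<circ> t) = P (dense_rank t)" if t: "\<forall>j. t j \<le> n" for t :: "'d \<Rightarrow> nat"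
    proof -
      define A where "A = range t"
      \<comment> \<open>The padding positions lie above \<open>n\<close>, hence above every entry of
        \<open>t\<close>, so no rank changes.\<close>
      define A' where "A' = A \<union> {n + 1..<n + 1 + (?d - card A)}"
      have An: "A \<subseteq> {..n}" "finite A" "card A \<le> ?d"
        using t by (auto simp: A_def card_image_le)
      have "A \<inter> {n + 1..<n + 1 + (?d - card A)} = {}"
        using An by auto
      then have A'card: "card A' = ?d"
        using An by (simp add: A'_def card_Un_disjoint)
      have A'sub: "A' \<subseteq> {..<n + 1 + ?d}" "finite A'"
        using An by (auto simp: A'_def)
      have inj: "inj_on h A'"
        using strict_mono_on_imp_inj_on[OF h(1)] A'sub by (auto intro: inj_on_subset)
      define S where "S = h ` A'"
      have S: "S \<in> nsets H ?d"
        using A'sub h(2) A'card inj by (auto simp: S_def nsets_def card_image)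
      then have Sf: "finite S" "card S = ?d"
        by (auto simp: nsets_def)
      \<comment> \<open>The position of \<open>h (t j)\<close> in the enumeration of
        \<open>S\<close> is the number of elements of \<open>S\<close> below it, and these all come
        from entries of \<open>t\<close>.\<close>
      have rS: "e S (dense_rank t j) = h (t j)" for j
      proof -
        have "h (t j) \<in> S"
          by (auto simp: S_def A'_def A_def)
        then obtain r where r: "r < ?d" "h (t j) = e S r"
          using e(1)[OF Sf(1)] Sf(2) by (auto simp: bij_betw_def)
        have "r = card {s \<in> e S ` {..<?d}. s < e S r}"
          using strict_mono_on_card_less[of ?d "e S" r] e(2)[OF Sf(1)] r Sf(2) by simp
        also have "\<dots> = card {s \<in> S. s < h (t j)}"
          using e(1)[OF Sf(1)] Sf(2) r by (simp add: bij_betw_def)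
        also have "{s \<in> S. s < h (t j)} = h ` {a \<in> A. a < t j}"
        proof -
          have less: "h a < h (t j) \<longleftrightarrow> a < t j" if "a \<in> A'" for a
          proof -
            have "t j \<in> A'"
              by (simp add: A'_def A_def)
            then show ?thesis
              using strict_mono_on_less[OF h(1)] A'sub(1) that by blast
          qed
          have "a < t j \<Longrightarrow> a \<in> A' \<Longrightarrow> a \<in> A" for a
            using t[rule_format, of j] by (auto simp: A'_def)
          moreover have "A \<subseteq> A'"
            by (simp add: A'_def)
          ultimately show ?thesis
            using less by (auto simp: S_def)
        qed
        also have "card \<dots> = card {a \<in> A. a < t j}"
          using inj by (intro card_image) (auto simp: A'_def intro: inj_on_subset)
        finally show ?thesis
          using r by (simp add: dense_rank_def A_def)
      qed
      have "P (dense_rank t) = col S (dense_rank t)"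
        using P(1)[OF S] by simp
      also have "\<dots> = \<Phi> (e S \<circ> dense_rank t)"
        using dense_rank_less_CARD[of t] by (simp add: col_def D_def)
      also have "e S \<circ> dense_rank t = h \<circ> t"
        using rS by auto
      finally show ?thesis ..
    qed
    moreover have "strict_mono_on {..n} h"
      using h(1) by (auto simp: strict_mono_on_def)
    moreover have "h ` {..n} \<subseteq> {..<N}"
      using h(2) H(2) by force
    moreover have "\<forall>\<rho>. (\<forall>j. \<rho> j < ?d) \<longrightarrow> P \<rho> \<in> K"
      using P(2) by (auto simp: KK_def D_def)
    ultimately show "\<exists>h P. strict_mono_on {..n} h \<and> h ` {..n} \<subseteq> {..<N} \<and>
      (\<forall>\<rho>. (\<forall>j. \<rho> j < ?d) \<longrightarrow> P \<rho> \<in> K) \<and>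
      (\<forall>t. (\<forall>j. t j \<le> n) \<longrightarrow> \<Phi> (h \<circ> t) = P (dense_rank t))"
      by blast
  qed
qed

section \<open>Cylinders in products of Lebesgue measure\<close>

lemma product_sigma_finite_lborel: "product_sigma_finite (\<lambda>_. lborel :: real measure)"
  by standard

text \<open>Renaming coordinates along an injection preserves the measure of boxes, and these
  determine the product measure.\<close>

lemma distr_PiM_reindex_lborel:
  assumes "finite I" "inj_on \<sigma> I"
  shows "distr (PiM (\<sigma> ` I) (\<lambda>_. lborel)) (PiM I (\<lambda>_. lborel :: real measure)) (\<lambda>x. \<lambda>i\<in>I. x (\<sigma> i)) =
    PiM I (\<lambda>_. lborel)"
proof (rule product_sigma_finite.PiM_eqI[OF product_sigma_finite_lborel])
  fix A :: "_ \<Rightarrow> real set"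
  assume A: "\<And>i. i \<in> I \<Longrightarrow> A i \<in> sets lborel"
  define B where "B k = A (the_inv_into I \<sigma> k)" for k
  have B: "B (\<sigma> i) = A i" if "i \<in> I" for i
    using that assms by (simp add: B_def the_inv_into_f_f)
  have meas: "(\<lambda>x. \<lambda>i\<in>I. x (\<sigma> i)) \<in> PiM (\<sigma> ` I) (\<lambda>_. lborel :: real measure) \<rightarrow>\<^sub>M PiM I (\<lambda>_. lborel)"
    by (intro measurable_restrict measurable_component_singleton) auto
  have "(\<lambda>x. \<lambda>i\<in>I. x (\<sigma> i)) -` Pi\<^sub>E I A \<inter> space (PiM (\<sigma> ` I) (\<lambda>_. lborel :: real measure)) =
    Pi\<^sub>E (\<sigma> ` I) B"
    using B by (auto simp: space_PiM PiE_iff)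
  then have "emeasure (distr (PiM (\<sigma> ` I) (\<lambda>_. lborel)) (PiM I (\<lambda>_. lborel)) (\<lambda>x. \<lambda>i\<in>I. x (\<sigma> i)))
      (Pi\<^sub>E I A) = emeasure (PiM (\<sigma> ` I) (\<lambda>_. lborel)) (Pi\<^sub>E (\<sigma> ` I) B)"
    using A assms(1) by (subst emeasure_distr[OF meas]) (auto intro!: sets_PiM_I_finite)
  also have "\<dots> = (\<Prod>k\<in>\<sigma> ` I. emeasure lborel (B k))"
    using A B assms by (intro product_sigma_finite.emeasure_PiM[OF product_sigma_finite_lborel]) auto
  also have "\<dots> = (\<Prod>i\<in>I. emeasure lborel (A i))"
    using B assms by (subst prod.reindex) auto
  finally show "emeasure (distr (PiM (\<sigma> ` I) (\<lambda>_. lborel)) (PiM I (\<lambda>_. lborel)) (\<lambda>x. \<lambda>i\<in>I. x (\<sigma> i)))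
      (Pi\<^sub>E I A) = (\<Prod>i\<in>I. emeasure lborel (A i))" .
qed (use assms in auto)

text \<open>Split the coordinates into those hit by \<open>\<sigma>\<close> and the rest: the event
  becomes a rectangle in the product of the two factors, whose first side is a renamed copy of
  \<open>W\<close>.\<close>

lemma emeasure_PiM_cylinder_lborel:
  fixes W :: "('i \<Rightarrow> real) set" and B :: "'k \<Rightarrow> real set"
  assumes fin: "finite K" and \<sigma>: "inj_on \<sigma> I" "\<sigma> ` I \<subseteq> K"
    and W: "W \<in> sets (PiM I (\<lambda>_. lborel))" and B: "\<And>k. k \<in> K - \<sigma> ` I \<Longrightarrow> B k \<in> sets lborel"
  shows "emeasure (PiM K (\<lambda>_. lborel))
      {x \<in> space (PiM K (\<lambda>_. lborel)). (\<lambda>i\<in>I. x (\<sigma> i)) \<in> W \<and> (\<forall>k\<in>K - \<sigma> ` I. x k \<in> B k)} =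
    emeasure (PiM I (\<lambda>_. lborel)) W * (\<Prod>k\<in>K - \<sigma> ` I. emeasure lborel (B k))" (is "emeasure _ ?S = _")
    and "{x \<in> space (PiM K (\<lambda>_. lborel)). (\<lambda>i\<in>I. x (\<sigma> i)) \<in> W \<and> (\<forall>k\<in>K - \<sigma> ` I. x k \<in> B k)}
      \<in> sets (PiM K (\<lambda>_. lborel))"
proof -
  interpret product_sigma_finite "\<lambda>_::'k. lborel :: real measure"
    by (rule product_sigma_finite_lborel)
  let ?M = "\<lambda>_. lborel :: real measure"
  define J where "J = K - \<sigma> ` I"
  have KJ: "K = \<sigma> ` I \<union> J" "\<sigma> ` I \<inter> J = {}" "finite J" "finite (\<sigma> ` I)" "finite I"
    using fin \<sigma> finite_subset[OF \<sigma>(2) fin] finite_imageD[OF _ \<sigma>(1)] by (simp_all add: J_def Un_absorb1)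
  have mI: "(\<lambda>x. \<lambda>i\<in>I. x (\<sigma> i)) \<in> PiM L ?M \<rightarrow>\<^sub>M PiM I ?M" if "\<sigma> ` I \<subseteq> L" for L
    using that by (intro measurable_restrict measurable_component_singleton) auto
  define W' where "W' = (\<lambda>x. \<lambda>i\<in>I. x (\<sigma> i)) -` W \<inter> space (PiM (\<sigma> ` I) ?M)"
  have W': "W' \<in> sets (PiM (\<sigma> ` I) ?M)"
    unfolding W'_def using mI W by (intro measurable_sets) auto
  have BJ: "Pi\<^sub>E J B \<in> sets (PiM J ?M)"
    using KJ B by (intro sets_PiM_I_finite) (auto simp: J_def)
  have "?S = ((\<lambda>x. \<lambda>i\<in>I. x (\<sigma> i)) -` W \<inter> space (PiM K ?M)) \<inter>
      ((\<lambda>x. restrict x J) -` Pi\<^sub>E J B \<inter> space (PiM K ?M))"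
    by (auto simp: J_def)
  also have "\<dots> \<in> sets (PiM K ?M)"
    using W \<sigma>(2) BJ by (intro sets.Int measurable_sets[OF mI] measurable_sets[OF measurable_restrict_subset])
      (auto simp: J_def)
  finally show S: "?S \<in> sets (PiM K ?M)" .
  have "emeasure (PiM K ?M) ?S = emeasure (distr (PiM (\<sigma> ` I) ?M \<Otimes>\<^sub>M PiM J ?M) (PiM K ?M)
      (merge (\<sigma> ` I) J)) ?S"
    using distr_merge[OF KJ(2,4,3)] KJ(1) by simp
  also have "\<dots> = emeasure (PiM (\<sigma> ` I) ?M \<Otimes>\<^sub>M PiM J ?M)
      (merge (\<sigma> ` I) J -` ?S \<inter> space (PiM (\<sigma> ` I) ?M \<Otimes>\<^sub>M PiM J ?M))"
    using S measurable_merge[of "\<sigma> ` I" J ?M] KJ(1) by (subst emeasure_distr) auto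
  also have "merge (\<sigma> ` I) J -` ?S \<inter> space (PiM (\<sigma> ` I) ?M \<Otimes>\<^sub>M PiM J ?M) = W' \<times> Pi\<^sub>E J B"
  proof -
    have "(\<lambda>i\<in>I. merge (\<sigma> ` I) J (x, y) (\<sigma> i)) = (\<lambda>i\<in>I. x (\<sigma> i))" for x y :: "'k \<Rightarrow> real"
      by (rule restrict_ext) (simp add: merge_def)
    moreover have "merge (\<sigma> ` I) J (x, y) k = y k" if "k \<in> J" for x y :: "'k \<Rightarrow> real" and k
      using that KJ(2) by (auto simp: merge_def)
    moreover have "merge (\<sigma> ` I) J (x, y) \<in> space (PiM K ?M)" for x y :: "'k \<Rightarrow> real"
      using KJ(1) by (auto simp: space_PiM PiE_iff merge_def extensional_def)
    ultimately show ?thesis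
      using KJ(2) unfolding W'_def J_def[symmetric]
      by (auto simp: space_pair_measure space_PiM PiE_iff)
  qed
  also have "emeasure (PiM (\<sigma> ` I) ?M \<Otimes>\<^sub>M PiM J ?M) (W' \<times> Pi\<^sub>E J B) =
      emeasure (PiM (\<sigma> ` I) ?M) W' * emeasure (PiM J ?M) (Pi\<^sub>E J B)"
    using W' BJ sigma_finite[OF KJ(3)] by (intro sigma_finite_measure.emeasure_pair_measure_Times) auto
  also have "emeasure (PiM (\<sigma> ` I) ?M) W' = emeasure (PiM I ?M) W"
    unfolding W'_def using W mI[of "\<sigma> ` I"]
    by (subst emeasure_distr[symmetric]) (auto simp: distr_PiM_reindex_lborel[OF KJ(5) \<sigma>(1)])
  also have "emeasure (PiM J ?M) (Pi\<^sub>E J B) = (\<Prod>k\<in>J. emeasure lborel (B k))"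
    using KJ B by (intro emeasure_PiM) (auto simp: J_def)
  finally show "emeasure (PiM K ?M) ?S =
      emeasure (PiM I ?M) W * (\<Prod>k\<in>K - \<sigma> ` I. emeasure lborel (B k))"
    by (simp only: J_def)
qed

text \<open>The cylinder formula with unrestricted remaining coordinates: each of them contributes
  an infinite factor, harmless because \<open>0 * \<infinity> = 0\<close> in
  \<open>ennreal\<close>.\<close>

lemma null_sets_PiM_reindex_lborel:
  assumes "finite K" "inj_on \<sigma> I" "\<sigma> ` I \<subseteq> K" and W: "W \<in> null_sets (PiM I (\<lambda>_. lborel :: real measure))"
  shows "{x \<in> space (PiM K (\<lambda>_. lborel)). (\<lambda>i\<in>I. x (\<sigma> i)) \<in> W} \<in> null_sets (PiM K (\<lambda>_. lborel))"
  using emeasure_PiM_cylinder_lborel[OF assms(1-3), of W "\<lambda>_. UNIV"] W by (auto simp: null_sets_def)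

section \<open>Lebesgue measure on vectors as a product measure\<close>

lemma borel_measurable_vec_lambda:
  fixes f :: "'d::finite \<Rightarrow> 'a \<Rightarrow> real"
  assumes "\<And>j. f j \<in> borel_measurable M"
  shows "(\<lambda>x. \<chi> j. f j x) \<in> borel_measurable M"
  unfolding borel_measurable_euclidean_space[of "\<lambda>x. \<chi> j. f j x"]
  using assms by (auto simp: Basis_vec_def inner_axis)

text \<open>Samples are functions measured by \<open>PiM\<close>, whereas colourings live on
  \<open>real ^ 'd\<close>; this bridges the two. Agreement on open boxes suffices, by uniqueness of
  Lebesgue measure.\<close>

lemma lborel_vec_eq_distr_PiM:
  "(lborel :: (real ^ 'd) measure) = distr (PiM UNIV (\<lambda>_. lborel)) borel (\<lambda>f. \<chi> j. f j)"
proof (rule lborel_eqI)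
  fix a b :: "real ^ 'd"
  assume le: "\<And>v. v \<in> Basis \<Longrightarrow> a \<bullet> v \<le> b \<bullet> v"
  have le': "a $ j \<le> b $ j" for j
    using le[of "axis j 1"] by (simp add: inner_axis axis_in_Basis_iff)
  have meas: "(\<lambda>f. \<chi> j. f j) \<in> PiM UNIV (\<lambda>_::'d. lborel :: real measure) \<rightarrow>\<^sub>M borel"
    by (rule borel_measurable_vec_lambda) auto
  have "(\<lambda>f. \<chi> j. f j) -` box a b \<inter> space (PiM UNIV (\<lambda>_::'d. lborel :: real measure)) =
    (\<Pi>\<^sub>E j\<in>UNIV. {a $ j<..<b $ j})"
    by (auto simp: mem_box_cart space_PiM PiE_iff)
  then have "emeasure (distr (PiM UNIV (\<lambda>_::'d. lborel)) borel (\<lambda>f. \<chi> j. f j)) (box a b) =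
    emeasure (PiM UNIV (\<lambda>_::'d. lborel)) (\<Pi>\<^sub>E j\<in>UNIV. {a $ j<..<b $ j})"
    by (subst emeasure_distr[OF meas]) auto
  also have "\<dots> = (\<Prod>j\<in>UNIV. emeasure lborel {a $ j<..<b $ j})"
    by (intro product_sigma_finite.emeasure_PiM[OF product_sigma_finite_lborel]) auto
  also have "\<dots> = ennreal (\<Prod>j\<in>UNIV. (b - a) $ j)"
    using le' by (simp add: prod_ennreal)
  also have "(\<Prod>j\<in>UNIV. (b - a) $ j) = (\<Prod>v\<in>Basis. (b - a) \<bullet> v)"
  proof -
    have B: "Basis = (\<lambda>j. axis j 1 :: real ^ 'd) ` UNIV"
      by (auto simp: Basis_vec_def)
    show ?thesis
      unfolding B by (subst prod.reindex) (auto simp: inj_on_def axis_eq_axis inner_axis)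
  qed
  finally show "emeasure (distr (PiM UNIV (\<lambda>_::'d. lborel)) borel (\<lambda>f. \<chi> j. f j)) (box a b) =
    ennreal (\<Prod>v\<in>Basis. (b - a) \<bullet> v)" .
qed simp

text \<open>With \<open>i\<close> injective, the entries \<open>x (i j)\<close> are distinct
  coordinates of \<open>x\<close>, so the vector they form follows Lebesgue measure, independently
  of the other coordinates. Repeated entries would confine it to a diagonal.\<close>

lemma emeasure_PiM_vec_cylinder:
  fixes X :: "(real ^ 'd) set" and i :: "'d \<Rightarrow> 'k" and B :: "'k \<Rightarrow> real set"
  assumes fin: "finite K" and i: "inj i" "range i \<subseteq> K"
    and X: "X \<in> sets borel" and B: "\<And>k. k \<in> K - range i \<Longrightarrow> B k \<in> sets lborel"
  shows "emeasure (PiM K (\<lambda>_. lborel))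
      {x \<in> space (PiM K (\<lambda>_. lborel)). (\<chi> j. x (i j)) \<in> X \<and> (\<forall>k\<in>K - range i. x k \<in> B k)} =
    emeasure lborel X * (\<Prod>k\<in>K - range i. emeasure lborel (B k))" (is ?th1)
    and "{x \<in> space (PiM K (\<lambda>_. lborel)). (\<chi> j. x (i j)) \<in> X \<and> (\<forall>k\<in>K - range i. x k \<in> B k)}
      \<in> sets (PiM K (\<lambda>_. lborel))" (is ?th2)
proof -
  define W where "W = (\<lambda>f. \<chi> j. f j) -` X \<inter> space (PiM UNIV (\<lambda>_::'d. lborel :: real measure))"
  have meas: "(\<lambda>f. \<chi> j. f j) \<in> PiM UNIV (\<lambda>_::'d. lborel :: real measure) \<rightarrow>\<^sub>M borel"
    by (rule borel_measurable_vec_lambda) auto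
  have W: "W \<in> sets (PiM UNIV (\<lambda>_. lborel))"
    unfolding W_def using X meas by (rule measurable_sets[rotated])
  have "emeasure lborel X = emeasure (PiM UNIV (\<lambda>_. lborel)) W"
    unfolding W_def using X by (subst lborel_vec_eq_distr_PiM) (simp add: emeasure_distr[OF meas])
  moreover have "(\<lambda>j\<in>UNIV. x (i j)) \<in> W \<longleftrightarrow> (\<chi> j. x (i j)) \<in> X" for x :: "'k \<Rightarrow> real"
    by (simp add: W_def space_PiM restrict_UNIV)
  ultimately show ?th1 ?th2
    using emeasure_PiM_cylinder_lborel[OF fin i W B] by simp_all
qed

lemma null_sets_PiM_vec:
  fixes X :: "(real ^ 'd) set"
  assumes "finite K" "inj i" "range i \<subseteq> K" "X \<in> null_sets lborel"
  shows "{x \<in> space (PiM K (\<lambda>_. lborel)). (\<chi> j. x (i j)) \<in> X} \<in> null_sets (PiM K (\<lambda>_. lborel))"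
  using emeasure_PiM_vec_cylinder[OF assms(1-3), of X "\<lambda>_. UNIV"] assms(4)
  by (auto simp: null_sets_def)

section \<open>Blow-ups of sets of positive measure\<close>

text \<open>Let \<open>g y\<close> be the measure of the fibre of \<open>E\<close> over the
  remaining coordinates \<open>y\<close>. By Fubini \<open>g\<close> has nonzero integral, so it is
  not almost everywhere zero. Over each \<open>y\<close> the copies indexed by \<open>Q\<close>
  range independently over the same fibre, so the new event has as its measure the integral of
  \<open>g y ^ card Q\<close>, which is nonzero too.\<close>

lemma duplicate_coordinate_not_null:
  fixes E :: "('k \<Rightarrow> real) set"
  assumes fin: "finite L" "finite Q" "Q \<noteq> {}" and disj: "L \<inter> Q = {}" "p \<notin> L"
    and E: "E \<in> sets (PiM (insert p L) (\<lambda>_. lborel))" "emeasure (PiM (insert p L) (\<lambda>_. lborel)) E \<noteq> 0"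
  shows "{x \<in> space (PiM (L \<union> Q) (\<lambda>_. lborel)). \<forall>q\<in>Q. (restrict x L)(p := x q) \<in> E}
      \<in> sets (PiM (L \<union> Q) (\<lambda>_. lborel))" (is "?A \<in> _")
    and "emeasure (PiM (L \<union> Q) (\<lambda>_. lborel))
      {x \<in> space (PiM (L \<union> Q) (\<lambda>_. lborel)). \<forall>q\<in>Q. (restrict x L)(p := x q) \<in> E} \<noteq> 0"
proof -
  interpret product_sigma_finite "\<lambda>_::'k. lborel :: real measure"
    by (rule product_sigma_finite_lborel)
  let ?M = "\<lambda>_::'k. lborel :: real measure"
  have m: "(\<lambda>x. (restrict x L)(p := x q)) \<in> PiM (L \<union> Q) ?M \<rightarrow>\<^sub>M PiM (insert p L) ?M" if "q \<in> Q" for q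
    using that by (intro measurable_fun_upd[where J = L] measurable_restrict_subset
        measurable_component_singleton) auto
  have "{x \<in> space (PiM (L \<union> Q) ?M). (restrict x L)(p := x q) \<in> E} \<in> sets (PiM (L \<union> Q) ?M)"
    if "q \<in> Q" for q
    using measurable_sets[OF m[OF that] E(1)] by (simp add: vimage_def Int_def conj_commute)
  then show A: "?A \<in> sets (PiM (L \<union> Q) ?M)"
    using fin(2) by (intro sets.sets_Collect_finite_All) auto
  define S where "S y = {t. y(p := t) \<in> E}" for y
  define g where "g y = emeasure lborel (S y)" for y
  have upd: "(\<lambda>(y, t). y(p := t)) \<in> PiM L ?M \<Otimes>\<^sub>M lborel \<rightarrow>\<^sub>M PiM (insert p L) ?M"
    using measurable_add_dim[of p L ?M] by simp
  have S: "S y \<in> sets lborel" if "y \<in> space (PiM L ?M)" for y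
  proof -
    have "(\<lambda>t. y(p := t)) \<in> lborel \<rightarrow>\<^sub>M PiM (insert p L) ?M"
      using that by (intro measurable_fun_upd[where J = L]) auto
    from measurable_sets[OF this E(1)] show ?thesis
      by (simp add: S_def vimage_def)
  qed
  have gi: "g y = (\<integral>\<^sup>+ t. indicator E (y(p := t)) \<partial>lborel)" if "y \<in> space (PiM L ?M)" for y
  proof -
    have "indicator E (y(p := t)) = (indicator (S y) t :: ennreal)" for t
      by (simp add: S_def indicator_def)
    then show ?thesis
      using S[OF that] by (simp add: g_def)
  qed
  have gm: "g \<in> borel_measurable (PiM L ?M)"
  proof -
    have "(\<lambda>y. \<integral>\<^sup>+ t. indicator E (y(p := t)) \<partial>lborel) \<in> borel_measurable (PiM L ?M)"
    proof (rule lborel.borel_measurable_nn_integral)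
      show "(\<lambda>(y, t). indicator E (y(p := t)) :: ennreal) \<in> borel_measurable (PiM L ?M \<Otimes>\<^sub>M lborel)"
        using measurable_compose[OF upd borel_measurable_indicator[OF E(1)]]
        by (simp add: case_prod_beta')
    qed
    then show ?thesis
      using gi by (subst measurable_cong) auto
  qed
  have "emeasure (PiM (insert p L) ?M) E = (\<integral>\<^sup>+ x. indicator E x \<partial>PiM (insert p L) ?M)"
    using E by simp
  also have "\<dots> = (\<integral>\<^sup>+ y. (\<integral>\<^sup>+ t. indicator E (y(p := t)) \<partial>lborel) \<partial>PiM L ?M)"
    using E by (intro product_nn_integral_insert fin disj) auto
  also have "\<dots> = (\<integral>\<^sup>+ y. g y \<partial>PiM L ?M)"
    using gi by (intro nn_integral_cong) auto
  finally have "\<not> (AE y in PiM L ?M. g y = 0)"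
    using E(2) gm by (simp add: nn_integral_0_iff_AE)
  moreover have "emeasure (PiM (L \<union> Q) ?M) ?A = (\<integral>\<^sup>+ y. g y ^ card Q \<partial>PiM L ?M)"
    unfolding emeasure_fold_integral[OF disj(1) fin(1,2) A]
  proof (rule nn_integral_cong)
    fix y assume y: "y \<in> space (PiM L ?M)"
    have r: "restrict (merge L Q (y, z)) L = y" for z
      using y disj(1) by (auto simp: fun_eq_iff space_PiM PiE_iff extensional_def)
    have "merge L Q (y, z) q = z q" if "q \<in> Q" for z q
      using that disj(1) by (auto simp: merge_def)
    moreover have "merge L Q (y, z) \<in> space (PiM (L \<union> Q) ?M)" for z
      by (auto simp: space_PiM PiE_iff merge_def extensional_def)
    ultimately have "(\<lambda>z. merge L Q (y, z)) -` ?A \<inter> space (PiM Q ?M) = (\<Pi>\<^sub>E q\<in>Q. S y)"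
      unfolding S_def using r by (auto simp: space_PiM PiE_iff)
    also have "emeasure (PiM Q ?M) \<dots> = (\<Prod>q\<in>Q. g y)"
      unfolding g_def using S[OF y] fin by (intro emeasure_PiM) auto
    finally show "emeasure (PiM Q ?M) ((\<lambda>z. merge L Q (y, z)) -` ?A \<inter> space (PiM Q ?M)) = g y ^ card Q"
      by simp
  qed
  moreover have "card Q > 0"
    using fin by (simp add: card_gt_0_iff)
  ultimately show "emeasure (PiM (L \<union> Q) ?M) ?A \<noteq> 0"
    using gm by (simp add: nn_integral_0_iff_AE)
qed

text \<open>The parts are blown up one at a time, each by duplicating a single coordinate
  \<open>N\<close>-fold; every duplication preserves positive measure.\<close>

theorem blow_up_not_null:
  fixes E :: "(nat \<Rightarrow> real) set" and l N :: nat
  assumes E: "E \<in> sets (PiM {..<l} (\<lambda>_. lborel))" "emeasure (PiM {..<l} (\<lambda>_. lborel)) E \<noteq> 0"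
    and "N > 0"
  obtains A where "A \<in> sets (PiM ({..<l} \<times> {..<N}) (\<lambda>_. lborel))"
    "emeasure (PiM ({..<l} \<times> {..<N}) (\<lambda>_. lborel)) A \<noteq> 0"
    "\<And>x a. x \<in> A \<Longrightarrow> (\<And>i. a i < N) \<Longrightarrow> (\<lambda>i\<in>{..<l}. x (i, a i)) \<in> E"
proof -
  let ?M = "\<lambda>_. lborel :: real measure"
  \<comment> \<open>After \<open>s\<close> rounds, parts below \<open>s\<close> have
    \<open>N\<close> copies and the others only copy \<open>0\<close>. The invariant covers the
    choices \<open>a\<close> that are \<open>0\<close> from \<open>s\<close> on.\<close>
  define T where "T s = {..<s} \<times> {..<N} \<union> {s..<l} \<times> {0}" for s
  have "\<exists>A \<in> sets (PiM (T s) ?M). emeasure (PiM (T s) ?M) A \<noteq> 0 \<and>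
    (\<forall>x\<in>A. \<forall>a. (\<forall>i. a i < N) \<longrightarrow> (\<forall>i\<ge>s. a i = 0) \<longrightarrow> (\<lambda>i\<in>{..<l}. x (i, a i)) \<in> E)" if "s \<le> l" for s
    using that
  proof (induction s)
    case 0
    have T0: "T 0 = (\<lambda>i. (i, 0)) ` {..<l}"
      by (auto simp: T_def)
    define A where "A = {x \<in> space (PiM (T 0) ?M). (\<lambda>i\<in>{..<l}. x (i, 0)) \<in> E}"
    have A: "A \<in> sets (PiM (T 0) ?M)" "emeasure (PiM (T 0) ?M) A \<noteq> 0"
      using emeasure_PiM_cylinder_lborel[of "T 0" "\<lambda>i. (i, 0)" "{..<l}" E "\<lambda>_. UNIV"] E
      by (auto simp: T0 A_def inj_on_def)
    have "(\<lambda>i\<in>{..<l}. x (i, a i)) \<in> E" if "x \<in> A" "\<forall>i\<ge>0. a i = 0" for x a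
    proof -
      have "a = (\<lambda>_. 0)"
        using that by auto
      then show ?thesis
        using that by (simp add: A_def)
    qed
    then show ?case
      by (intro bexI[OF _ A(1)] conjI A(2) ballI allI impI)
  next
    case (Suc s)
    then have "s \<le> l"
      by simp
    from Suc.IH[OF this] obtain A where A: "A \<in> sets (PiM (T s) ?M)" "emeasure (PiM (T s) ?M) A \<noteq> 0"
      and A3: "\<forall>x\<in>A. \<forall>a. (\<forall>i. a i < N) \<longrightarrow> (\<forall>i\<ge>s. a i = 0) \<longrightarrow> (\<lambda>i\<in>{..<l}. x (i, a i)) \<in> E"
      by (elim bexE conjE) (rule that)
    define L where "L = T s - {(s, 0)}"
    define Q where "Q = {s} \<times> {..<N}"
    have ins: "insert (s, 0) L = T s" and un: "L \<union> Q = T (Suc s)"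
      using Suc.prems \<open>N > 0\<close> by (auto simp: L_def Q_def T_def)
    note dup = duplicate_coordinate_not_null[of L Q "(s, 0)" A, unfolded ins un]
    have *: "finite L" "finite Q" "Q \<noteq> {}" "L \<inter> Q = {}" "(s, 0) \<notin> L"
      using \<open>N > 0\<close> by (auto simp: L_def Q_def T_def)
    show ?case
    proof (rule bexI[OF _ dup(1)[OF * A(1,2)]], intro conjI ballI allI impI)
      fix x a
      assume x: "x \<in> {x \<in> space (PiM (T (Suc s)) ?M). \<forall>q\<in>Q. (restrict x L)((s, 0) := x q) \<in> A}"
        and a: "\<forall>i. a i < N" "\<forall>i\<ge>Suc s. a i = 0"
      have "(restrict x L)((s, 0) := x (s, a s)) \<in> A"
        using x a by (auto simp: Q_def)
      \<comment> \<open>The copy chosen in part \<open>s\<close> is put in the place of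
        \<open>(s, 0)\<close>. This turns the transversal into one of the previous round, with index
        \<open>0\<close> in part \<open>s\<close>.\<close>
      from A3[THEN bspec, OF this, THEN spec, of "\<lambda>i. if i \<ge> s then 0 else a i"]
      have "(\<lambda>i\<in>{..<l}. ((restrict x L)((s, 0) := x (s, a s))) (i, if i \<ge> s then 0 else a i)) \<in> E"
        using a \<open>N > 0\<close> by auto
      also have "(\<lambda>i\<in>{..<l}. ((restrict x L)((s, 0) := x (s, a s))) (i, if i \<ge> s then 0 else a i)) =
        (\<lambda>i\<in>{..<l}. x (i, a i))"
        using a by (intro restrict_ext) (auto simp: L_def T_def)
      finally show "(\<lambda>i\<in>{..<l}. x (i, a i)) \<in> E" .
    qed (use dup(2)[OF * A(1,2)] in simp)
  qed
  from this[OF order_refl] obtain A where A: "A \<in> sets (PiM (T l) ?M)" "emeasure (PiM (T l) ?M) A \<noteq> 0"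
    and A3: "\<forall>x\<in>A. \<forall>a. (\<forall>i. a i < N) \<longrightarrow> (\<forall>i\<ge>l. a i = 0) \<longrightarrow> (\<lambda>i\<in>{..<l}. x (i, a i)) \<in> E"
    by (elim bexE conjE) (rule that)
  have T: "T l = {..<l} \<times> {..<N}"
    by (auto simp: T_def)
  show thesis
  proof (rule that[OF A[unfolded T]])
    fix x and a :: "nat \<Rightarrow> nat"
    assume "x \<in> A" "\<And>i. a i < N"
    with A3[THEN bspec, THEN spec, of x "\<lambda>i. if i < l then a i else 0"] \<open>N > 0\<close>
    have "(\<lambda>i\<in>{..<l}. x (i, if i < l then a i else 0)) \<in> E"
      by simp
    also have "(\<lambda>i\<in>{..<l}. x (i, if i < l then a i else 0)) = (\<lambda>i\<in>{..<l}. x (i, a i))"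
      by (rule restrict_ext) simp
    finally show "(\<lambda>i\<in>{..<l}. x (i, a i)) \<in> E" .
  qed
qed

text \<open>By Fubini: once the coordinates other than \<open>p\<close> are fixed, the fibre is a
  single point.\<close>

lemma ties_null:
  assumes "finite K" "p \<in> K" "q \<in> K" "p \<noteq> q"
  shows "{x \<in> space (PiM K (\<lambda>_. lborel :: real measure)). x p = x q} \<in> null_sets (PiM K (\<lambda>_. lborel))"
    (is "?S \<in> _")
proof -
  interpret product_sigma_finite "\<lambda>_. lborel :: real measure"
    by (rule product_sigma_finite_lborel)
  let ?M = "\<lambda>_. lborel :: real measure"
  define L where "L = K - {p}"
  have K: "K = insert p L" "finite L" "p \<notin> L" "q \<in> L"
    using assms by (auto simp: L_def)
  have [measurable]: "(\<lambda>x. x p) \<in> PiM K ?M \<rightarrow>\<^sub>M borel" "(\<lambda>x. x q) \<in> PiM K ?M \<rightarrow>\<^sub>M borel"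
    using assms measurable_component_singleton[of _ K ?M] by auto
  have S: "?S \<in> sets (PiM K ?M)"
    by measurable
  then have "emeasure (PiM K ?M) ?S = (\<integral>\<^sup>+ x. indicator ?S x \<partial>PiM (insert p L) ?M)"
    by (simp add: K(1))
  also have "\<dots> = (\<integral>\<^sup>+ y. (\<integral>\<^sup>+ t. indicator ?S (y(p := t)) \<partial>lborel) \<partial>PiM L ?M)"
    using S K by (intro product_nn_integral_insert) auto
  also have "\<dots> = (\<integral>\<^sup>+ y. (\<integral>\<^sup>+ t. indicator {y q} t \<partial>lborel) \<partial>PiM L ?M)"
    using K assms(4) by (intro nn_integral_cong) (auto simp: indicator_def space_PiM PiE_iff extensional_def)
  also have "\<dots> = 0"
    by simp
  finally show ?thesis
    using S by auto
qed

section \<open>Parts of the unit interval and compact approximation\<close>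

text \<open>Half-open on the left to agree with the ceiling in \<open>part_homogeneous\<close>, and
  numbered from \<open>0\<close>, so part \<open>s\<close> corresponds to the ceiling
  \<open>s + 1\<close>.\<close>

definition unit_part :: "nat \<Rightarrow> nat \<Rightarrow> real set" where
  "unit_part l s = {real s / real l<..(real s + 1) / real l}"

definition part_index :: "nat \<Rightarrow> real \<Rightarrow> nat" where
  "part_index l t = nat (\<lceil>real l * t\<rceil> - 1)"

definition part_box :: "nat \<Rightarrow> ('d \<Rightarrow> nat) \<Rightarrow> (real ^ 'd) set" where
  "part_box l i = {y. \<forall>j. y $ j \<in> unit_part l (i j)}"

lemma part_index_eqI:
  assumes "l > 0" "t \<in> unit_part l s"
  shows "part_index l t = s"
proof -
  have "real s < real l * t" "real l * t \<le> real s + 1"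
    using assms by (auto simp: unit_part_def field_simps)
  then have "\<lceil>real l * t\<rceil> = int s + 1"
    by linarith
  then show ?thesis
    by (simp add: part_index_def)
qed

lemma in_part_part_index:
  assumes "l > 0" "t \<in> {0<..1}"
  shows "t \<in> unit_part l (part_index l t)" "part_index l t < l"
proof -
  have pos: "0 < real l * t" and le: "real l * t \<le> real l"
    using assms by auto
  have "1 \<le> \<lceil>real l * t\<rceil>" "\<lceil>real l * t\<rceil> \<le> int l"
    using pos le by linarith+
  then have s: "real (part_index l t) = of_int \<lceil>real l * t\<rceil> - 1" and "part_index l t < l"
    unfolding part_index_def by (auto simp: nat_less_iff)
  then show "part_index l t < l"
    by simp
  have "real (part_index l t) < real l * t" "real l * t \<le> real (part_index l t) + 1"
    unfolding s by linarith+
  then show "t \<in> unit_part l (part_index l t)"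
    using assms(1) by (auto simp: unit_part_def field_simps)
qed

lemma part_subset_unit:
  assumes "s < l"
  shows "unit_part l s \<subseteq> {0<..1}"
proof
  fix t assume t: "t \<in> unit_part l s"
  have "0 \<le> real s / real l" "(real s + 1) / real l \<le> 1"
    using assms by (auto simp: field_simps)
  with t show "t \<in> {0<..1}"
    unfolding unit_part_def greaterThanAtMost_iff by linarith
qed

lemma part_less:
  assumes "s < s'" "t \<in> unit_part l s" "t' \<in> unit_part l s'"
  shows "t < t'"
proof -
  have "(real s + 1) / real l \<le> real s' / real l"
    using assms(1) by (intro divide_right_mono) auto
  then show ?thesis
    using assms(2,3) by (auto simp: unit_part_def)
qed

lemma part_diff_less:
  assumes "l > 0" "t \<in> unit_part l s" "t' \<in> unit_part l s"
  shows "\<bar>t - t'\<bar> < 1 / real l"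
  using assms by (auto simp: unit_part_def abs_less_iff add_divide_distrib)

lemma emeasure_part: "l > 0 \<Longrightarrow> emeasure lborel (unit_part l s) = ennreal (1 / real l)"
  by (simp add: unit_part_def divide_right_mono add_divide_distrib)

lemma part_borel [measurable]: "unit_part l s \<in> sets borel"
  by (simp add: unit_part_def)

lemma
  fixes A :: "'d::finite \<Rightarrow> real set"
  assumes A: "\<And>j. A j \<in> sets borel"
  shows emeasure_lborel_vec_box: "emeasure lborel {y. \<forall>j. y $ j \<in> A j} = (\<Prod>j\<in>UNIV. emeasure lborel (A j))"
    and borel_vec_box: "{y. \<forall>j. y $ j \<in> A j} \<in> sets (borel :: (real ^ 'd) measure)"
proof -
  have meas: "(\<lambda>f. \<chi> j. f j) \<in> PiM UNIV (\<lambda>_::'d. lborel :: real measure) \<rightarrow>\<^sub>M borel"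
    by (rule borel_measurable_vec_lambda) auto
  have "(\<lambda>y. y $ j) \<in> borel_measurable (borel :: (real ^ 'd) measure)" for j
    by (intro borel_measurable_continuous_onI continuous_intros)
  from measurable_sets[OF this A] have "{y. y $ j \<in> A j} \<in> sets (borel :: (real ^ 'd) measure)" for j
    by (simp add: vimage_def)
  moreover have "{y. \<forall>j. y $ j \<in> A j} = (\<Inter>j. {y. y $ j \<in> A j})"
    by auto
  ultimately show X: "{y. \<forall>j. y $ j \<in> A j} \<in> sets (borel :: (real ^ 'd) measure)"
    by (auto intro!: sets.finite_INT)
  have "emeasure lborel {y. \<forall>j. y $ j \<in> A j} =
    emeasure (PiM UNIV (\<lambda>_::'d. lborel)) ((\<lambda>f. \<chi> j. f j) -` {y. \<forall>j. y $ j \<in> A j} \<inter> space (PiM UNIV (\<lambda>_::'d. lborel)))"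
    using X by (subst lborel_vec_eq_distr_PiM) (simp add: emeasure_distr[OF meas])
  also have "(\<lambda>f. \<chi> j. f j) -` {y. \<forall>j. y $ j \<in> A j} \<inter> space (PiM UNIV (\<lambda>_::'d. lborel)) = Pi\<^sub>E UNIV A"
    by (auto simp: space_PiM PiE_iff)
  also have "emeasure (PiM UNIV (\<lambda>_::'d. lborel)) (Pi\<^sub>E UNIV A) = (\<Prod>j\<in>UNIV. emeasure lborel (A j))"
    using A by (intro product_sigma_finite.emeasure_PiM[OF product_sigma_finite_lborel]) auto
  finally show "emeasure lborel {y. \<forall>j. y $ j \<in> A j} = (\<Prod>j\<in>UNIV. emeasure lborel (A j))" .
qed

lemma part_box_borel [measurable]: "part_box l i \<in> sets borel"
  unfolding part_box_def by (rule borel_vec_box) simp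

lemma unit_cube_borel [measurable]: "unit_cube \<in> sets borel"
  unfolding unit_cube_def by (rule borel_vec_box) simp

lemma emeasure_part_box:
  "l > 0 \<Longrightarrow> emeasure lborel (part_box l i :: (real ^ 'd) set) = ennreal ((1 / real l) ^ CARD('d))"
  unfolding part_box_def by (subst emeasure_lborel_vec_box) (simp_all add: emeasure_part ennreal_power)

text \<open>Delete the diagonals from the colour classes and approximate each from inside by a
  closed set. On the compact union \<open>K\<close> the colouring is continuous, hence uniformly
  continuous, so nearby points share a colour; and \<open>K\<close> keeps a positive distance from
  the closed set of diagonal points.\<close>

lemma compact_core:
  fixes F :: "real ^ 'd \<Rightarrow> nat"
  assumes F: "measurable_colouring k F" and "\<eta> > 0"
  obtains K \<delta> where "compact K" "K \<subseteq> unit_cube" "emeasure lborel (unit_cube - K) \<le> ennreal \<eta>" "\<delta> > 0"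
    "\<And>x y. x \<in> K \<Longrightarrow> y \<in> K \<Longrightarrow> (\<And>j. \<bar>x $ j - y $ j\<bar> < \<delta>) \<Longrightarrow> F x = F y"
    "\<And>x j j'. x \<in> K \<Longrightarrow> j \<noteq> j' \<Longrightarrow> \<delta> \<le> \<bar>x $ j - x $ j'\<bar>"
proof -
  define D where "D = (\<Union>p\<in>{(j, j'). j \<noteq> j'}. {x :: real ^ 'd. x $ fst p = x $ snd p})"
  have hyper: "negligible {x :: real ^ 'd. x $ j = x $ j'}" if "j \<noteq> j'" for j j'
  proof -
    have "{x :: real ^ 'd. x $ j = x $ j'} = {x. (axis j 1 - axis j' 1) \<bullet> x = 0}"
      by (simp add: inner_diff_left inner_axis')
    moreover have "axis j 1 - axis j' 1 \<noteq> (0 :: real ^ 'd)"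
      using that by (simp add: axis_eq_axis)
    ultimately show ?thesis
      using negligible_hyperplane by metis
  qed
  have Dclosed: "closed D"
    unfolding D_def by (intro closed_UN ballI closed_Collect_eq continuous_intros) simp
  have Dnull: "D \<in> null_sets lebesgue"
    unfolding D_def negligible_iff_null_sets[symmetric]
    using hyper by (intro negligible_Union) auto
  define S where "S c = {x \<in> unit_cube. F x = c} - D" for c
  \<comment> \<open>An equal share for each of the \<open>k\<close> colour classes; the
    \<open>+ 1\<close> keeps the denominator positive.\<close>
  define e where "e = \<eta> / (real k + 1)"
  have e: "e > 0" "real k * e \<le> \<eta>"
    using \<open>\<eta> > 0\<close> by (auto simp: e_def field_simps)
  have "\<exists>T. closed T \<and> T \<subseteq> S c \<and> emeasure lebesgue (S c - T) < ennreal e" if "c \<in> {1..k}" for c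
  proof -
    have "S c \<in> sets lebesgue"
      using F that Dclosed by (auto simp: S_def measurable_colouring_def intro!: sets.Diff)
    from sets_lebesgue_inner_closed[OF this e(1)] show ?thesis
      by metis
  qed
  then obtain T where T: "\<And>c. c \<in> {1..k} \<Longrightarrow> closed (T c)" "\<And>c. c \<in> {1..k} \<Longrightarrow> T c \<subseteq> S c"
    "\<And>c. c \<in> {1..k} \<Longrightarrow> emeasure lebesgue (S c - T c) < ennreal e"
    by metis
  define K where "K = (\<Union>c\<in>{1..k}. T c)"
  have Kcube: "K \<subseteq> unit_cube" and KD: "K \<inter> D = {}"
    using T(2) unfolding K_def S_def by blast+
  have "(unit_cube :: (real ^ 'd) set) \<subseteq> cbox 0 1"
    by (auto simp: unit_cube_def mem_box_cart less_imp_le)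
  then have "bounded K"
    using Kcube bounded_cbox bounded_subset by blast
  moreover have "closed K"
    unfolding K_def using T(1) by (intro closed_UN) auto
  ultimately have K: "compact K"
    by (simp add: compact_eq_bounded_closed)
  have Sc: "S c - T c \<in> sets lebesgue" if "c \<in> {1..k}" for c
    using F that Dclosed T(1)[OF that] by (auto simp: S_def measurable_colouring_def intro!: sets.Diff)
  have "emeasure lborel (unit_cube - K) = emeasure lebesgue (unit_cube - K)"
    using \<open>closed K\<close> by simp
  also have "\<dots> \<le> emeasure lebesgue (D \<union> (\<Union>c\<in>{1..k}. S c - T c))"
  proof (rule emeasure_mono)
    show "unit_cube - K \<subseteq> D \<union> (\<Union>c\<in>{1..k}. S c - T c)"
      using F by (auto simp: K_def S_def measurable_colouring_def Pi_iff)
    show "D \<union> (\<Union>c\<in>{1..k}. S c - T c) \<in> sets lebesgue"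
      using Sc Dnull by (intro sets.Un sets.finite_UN) auto
  qed
  also have "\<dots> \<le> emeasure lebesgue D + emeasure lebesgue (\<Union>c\<in>{1..k}. S c - T c)"
    using Sc Dnull by (intro emeasure_subadditive sets.finite_UN) auto
  also have "\<dots> = emeasure lebesgue (\<Union>c\<in>{1..k}. S c - T c)"
    using Dnull by (simp add: null_setsD1)
  also have "\<dots> \<le> (\<Sum>c\<in>{1..k}. emeasure lebesgue (S c - T c))"
    using Sc by (intro emeasure_subadditive_finite) auto
  also have "\<dots> \<le> (\<Sum>c\<in>{1..k}. ennreal e)"
    using T(3) by (intro sum_mono less_imp_le) auto
  also have "\<dots> = ennreal (real k * e)"
    using e by (simp add: ennreal_mult' ennreal_of_nat_eq_real_of_nat)
  also have "\<dots> \<le> ennreal \<eta>"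
    using e by (intro ennreal_leI)
  finally have meas: "emeasure lborel (unit_cube - K) \<le> ennreal \<eta>" .
  have "continuous_on K (\<lambda>x. real (F x))"
    unfolding K_def
  proof (rule continuous_on_closed_Union)
    fix c assume c: "c \<in> {1..k}"
    have "continuous_on (T c) (\<lambda>x. real c)"
      by simp
    then show "continuous_on (T c) (\<lambda>x. real (F x))"
      by (rule continuous_on_eq) (use T(2)[OF c] in \<open>auto simp: S_def\<close>)
  qed (use T in auto)
  then have "uniformly_continuous_on K (\<lambda>x. real (F x))"
    using K by (rule compact_uniformly_continuous)
  \<comment> \<open>Colours are natural numbers, so a difference below \<open>1\<close> means
    equality.\<close>
  then obtain \<delta>1 where \<delta>1: "\<delta>1 > 0" "\<And>x y. x \<in> K \<Longrightarrow> y \<in> K \<Longrightarrow> dist y x < \<delta>1 \<Longrightarrow> dist (real (F y)) (real (F x)) < 1"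
    unfolding uniformly_continuous_on_def using zero_less_one by metis
  obtain \<delta>2 where \<delta>2: "\<delta>2 > 0" "\<And>x y. x \<in> K \<Longrightarrow> y \<in> D \<Longrightarrow> \<delta>2 \<le> dist x y"
    using separate_compact_closed[OF K Dclosed KD] by metis
  \<comment> \<open>Dividing by the dimension turns coordinatewise closeness into closeness in norm,
    via the sum of the coordinate differences.\<close>
  define \<delta> where "\<delta> = min (\<delta>1 / CARD('d)) \<delta>2"
  show thesis
  proof (rule that[OF K Kcube meas])
    show "\<delta> > 0"
      using \<delta>1 \<delta>2 by (simp add: \<delta>_def)
    fix x assume x: "x \<in> K"
    {
      fix y assume y: "y \<in> K" and xy: "\<And>j. \<bar>x $ j - y $ j\<bar> < \<delta>"
      have "dist x y \<le> (\<Sum>j\<in>UNIV. \<bar>x $ j - y $ j\<bar>)"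
        using norm_le_l1_cart[of "x - y"] by (simp add: dist_norm)
      also have "\<dots> < (\<Sum>j\<in>(UNIV :: 'd set). \<delta>1 / CARD('d))"
        using xy by (intro sum_strict_mono) (auto simp: \<delta>_def)
      also have "\<dots> = \<delta>1"
        by simp
      finally show "F x = F y"
        using \<delta>1(2)[OF y x] by (simp add: dist_real_def)
    }
    {
      fix j j' :: 'd assume "j \<noteq> j'"
      \<comment> \<open>Moving coordinate \<open>j\<close> onto the value of coordinate
        \<open>j'\<close> gives a diagonal point at distance exactly
        \<open>\<bar>x $ j - x $ j'\<bar>\<close>.\<close>
      define y where "y = x - axis j (x $ j - x $ j')"
      have "y $ j = y $ j'"
        using \<open>j \<noteq> j'\<close> by (simp add: y_def axis_def)
      then have "y \<in> D"
        using \<open>j \<noteq> j'\<close> by (auto simp: D_def)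
      then have "\<delta>2 \<le> dist x y"
        using \<delta>2 x by blast
      also have "dist x y = \<bar>x $ j - x $ j'\<bar>"
        by (simp add: y_def dist_norm norm_eq_sqrt_inner inner_axis_axis)
      finally show "\<delta> \<le> \<bar>x $ j - x $ j'\<bar>"
        by (simp add: \<delta>_def)
    }
  qed
qed

text \<open>Sample events must be measurable for products of Borel sigma-algebras. Each Lebesgue
  measurable class is therefore replaced by a Borel subset, and the missing points are covered by
  the null set \<open>W\<close>.\<close>

lemma borel_colour_classes:
  fixes F :: "real ^ 'd \<Rightarrow> nat"
  assumes F: "measurable_colouring k F"
  obtains B W where "\<And>c. c \<in> {1..k} \<Longrightarrow> B c \<in> sets borel" "\<And>c x. c \<in> {1..k} \<Longrightarrow> x \<in> B c \<Longrightarrow> F x = c"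
    "W \<in> null_sets lborel" "unit_cube \<subseteq> W \<union> (\<Union>c\<in>{1..k}. B c)"
proof -
  define approx where "approx c S N \<longleftrightarrow> S \<in> sets borel \<and> N \<in> null_sets lborel \<and>
    S \<subseteq> {x \<in> unit_cube. F x = c} \<and> {x \<in> unit_cube. F x = c} \<subseteq> S \<union> N" for c S N
  have "\<exists>S N. approx c S N" if "c \<in> {1..k}" for c
  proof -
    have "{x \<in> unit_cube. F x = c} \<in> sets (completion lborel)"
      using F that by (simp add: measurable_colouring_def)
    then obtain S N N' where S: "{x \<in> unit_cube. F x = c} = S \<union> N" "N \<subseteq> N'"
      "N' \<in> null_sets lborel" "S \<in> sets lborel"
      by (rule sets_completionE)
    show ?thesis
      unfolding approx_def S(1) using S(2-4) by (intro exI[of _ S] exI[of _ N']) auto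
  qed
  then obtain B N where "\<And>c. c \<in> {1..k} \<Longrightarrow> approx c (B c) (N c)"
    by metis
  then have B: "\<And>c. c \<in> {1..k} \<Longrightarrow> B c \<in> sets borel"
    "\<And>c. c \<in> {1..k} \<Longrightarrow> B c \<subseteq> {x \<in> unit_cube. F x = c}"
    and N: "\<And>c. c \<in> {1..k} \<Longrightarrow> N c \<in> null_sets lborel"
    "\<And>c. c \<in> {1..k} \<Longrightarrow> {x \<in> unit_cube. F x = c} \<subseteq> B c \<union> N c"
    by (simp_all add: approx_def)
  show thesis
  proof (rule that[of B "\<Union>c\<in>{1..k}. N c"])
    show "(\<Union>c\<in>{1..k}. N c) \<in> null_sets lborel"
      using N(1) by (intro null_sets.finite_UN) auto
    show "unit_cube \<subseteq> (\<Union>c\<in>{1..k}. N c) \<union> (\<Union>c\<in>{1..k}. B c)"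
    proof
      fix x :: "real ^ 'd" assume x: "x \<in> unit_cube"
      then have "F x \<in> {1..k}"
        using F by (auto simp: measurable_colouring_def)
      with N(2)[OF this] x show "x \<in> (\<Union>c\<in>{1..k}. N c) \<union> (\<Union>c\<in>{1..k}. B c)"
        by blast
    qed
  qed (use B in auto)
qed

text \<open>\<open>A\<close> may be non-measurable, since it will be the disagreement set with an
  arbitrary \<open>G\<close>; \<open>measure\<close> then takes its default value \<open>0\<close>
  and the bound persists.\<close>

lemma measure_lebesgue_le:
  assumes "A \<subseteq> B" "B \<in> sets borel" "emeasure lborel B \<le> ennreal e" "e \<ge> 0"
  shows "measure lebesgue A \<le> e"
proof (cases "A \<in> sets lebesgue")
  case True
  have "emeasure lebesgue A \<le> emeasure lebesgue B"
    using assms by (intro emeasure_mono) auto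
  also have "\<dots> \<le> ennreal e"
    using assms by simp
  finally show ?thesis
    using assms(4) by (simp add: measure_def enn2real_leI)
next
  case False
  then show ?thesis
    using assms(4) by (simp add: measure_notin_sets)
qed

section \<open>Random choice of one point in each part\<close>

definition cell_tuples :: "nat \<Rightarrow> ('d \<Rightarrow> nat) set" where
  "cell_tuples l = {i. inj i \<and> range i \<subseteq> {..<l}}"

lemma finite_cell_tuples: "finite (cell_tuples l :: ('d::finite \<Rightarrow> nat) set)"
proof (rule finite_subset)
  show "cell_tuples l \<subseteq> UNIV \<rightarrow>\<^sub>E {..<l}"
    by (auto simp: cell_tuples_def)
  show "finite ((UNIV :: 'd set) \<rightarrow>\<^sub>E {..<l})"
    by (simp add: finite_PiE)
qed

lemma part_box_subset_unit_cube:
  assumes "range i \<subseteq> {..<l}"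
  shows "part_box l i \<subseteq> unit_cube"
proof
  fix x assume x: "x \<in> part_box l i"
  have "x $ j \<in> {0<..1}" for j
  proof -
    have "i j < l"
      using assms by auto
    then show ?thesis
      using x part_subset_unit[of "i j" l] unfolding part_box_def by blast
  qed
  then show "x \<in> unit_cube"
    by (simp add: unit_cube_def)
qed

lemma disjoint_part_boxes:
  assumes "l > 0"
  shows "disjoint_family_on (\<lambda>i. part_box l i :: (real ^ 'd) set) I"
proof (clarsimp simp: disjoint_family_on_def disjoint_iff)
  fix i i' :: "'d \<Rightarrow> nat" and x :: "real ^ 'd"
  assume "i \<noteq> i'" and x: "x \<in> part_box l i" "x \<in> part_box l i'"
  have "i j = i' j" for j
  proof -
    have "x $ j \<in> unit_part l (i j)" "x $ j \<in> unit_part l (i' j)"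
      using x by (simp_all add: part_box_def)
    then show ?thesis
      using part_index_eqI[OF assms] by metis
  qed
  with \<open>i \<noteq> i'\<close> show False
    by auto
qed

text \<open>A first-moment argument. Put one uniform point in each part. For an off-diagonal cell
  \<open>i\<close>, one with distinct parts, the vector of chosen points is uniform in that cell. So
  the expected number of cells whose vector misses \<open>K\<close> is
  \<open>real l ^ CARD('d)\<close> times the volume of these cells outside \<open>K\<close>, hence
  at most \<open>\<eta> * real l ^ CARD('d)\<close>. Twice this bound cannot be exceeded almost
  surely, and the null set \<open>W\<close> is avoided almost surely.\<close>

lemma few_bad_cells_not_null:
  fixes K W :: "(real ^ 'd) set"
  assumes l: "l \<ge> CARD('d)" and K: "K \<in> sets borel" "emeasure lborel (unit_cube - K) \<le> ennreal \<eta>"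
    and \<eta>: "\<eta> > 0" and W: "W \<in> null_sets lborel"
  obtains E where "E \<in> sets (PiM {..<l} (\<lambda>_. lborel))" "emeasure (PiM {..<l} (\<lambda>_. lborel)) E \<noteq> 0"
    "\<And>z s. z \<in> E \<Longrightarrow> s < l \<Longrightarrow> z s \<in> unit_part l s"
    "\<And>z i. z \<in> E \<Longrightarrow> i \<in> cell_tuples l \<Longrightarrow> (\<chi> j. z (i j)) \<notin> W"
    "\<And>z. z \<in> E \<Longrightarrow>
      real (card {i \<in> cell_tuples l. (\<chi> j. z (i j)) \<notin> K}) \<le> 2 * \<eta> * real l ^ CARD('d)"
proof -
  let ?P = "PiM {..<l} (\<lambda>_. lborel :: real measure)"
  let ?d = "CARD('d)"
  have l0: "l > 0"
    using l zero_less_card_finite[where 'a = 'd] by linarith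
  define I where "I = (cell_tuples l :: ('d \<Rightarrow> nat) set)"
  have I: "finite I" "\<And>i. i \<in> I \<Longrightarrow> inj i" "\<And>i. i \<in> I \<Longrightarrow> range i \<subseteq> {..<l}"
    using finite_cell_tuples by (auto simp: I_def cell_tuples_def)
  \<comment> \<open>The sampling space is left unnormalised, with total mass
    \<open>(1 / real l) ^ l\<close>.\<close>
  define P0 where "P0 = (\<Pi>\<^sub>E s\<in>{..<l}. unit_part l s)"
  have P0: "P0 \<in> sets ?P"
    unfolding P0_def by (intro sets_PiM_I_finite) auto
  have "emeasure ?P P0 = (\<Prod>s\<in>{..<l}. emeasure lborel (unit_part l s))"
    unfolding P0_def by (intro product_sigma_finite.emeasure_PiM[OF product_sigma_finite_lborel]) auto
  also have "\<dots> = ennreal ((1 / real l) ^ l)"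
    using l0 by (simp add: emeasure_part ennreal_power)
  finally have P0_eq: "emeasure ?P P0 = ennreal ((1 / real l) ^ l)" .
  define bad where "bad i = {z \<in> P0. (\<chi> j. z (i j)) \<notin> K}" for i :: "'d \<Rightarrow> nat"
  \<comment> \<open>Written as a cylinder: the box takes up the constraints on the coordinates in
    the range of \<open>i\<close>.\<close>
  have bad_eq: "bad i = {z \<in> space ?P. (\<chi> j. z (i j)) \<in> part_box l i - K \<and> (\<forall>s\<in>{..<l} - range i. z s \<in> unit_part l s)}"
    if "i \<in> I" for i
  proof -
    have "(\<forall>s\<in>{..<l}. z s \<in> unit_part l s) \<longleftrightarrow>
      (\<forall>j. z (i j) \<in> unit_part l (i j)) \<and> (\<forall>s\<in>{..<l} - range i. z s \<in> unit_part l s)" for z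
      using I(3)[OF that] by blast
    then show ?thesis
      by (auto simp: bad_def P0_def space_PiM PiE_iff part_box_def)
  qed
  have bad: "bad i \<in> sets ?P"
    "emeasure ?P (bad i) = emeasure lborel (part_box l i - K) * ennreal ((1 / real l) ^ (l - ?d))" if "i \<in> I" for i
  proof -
    note cyl = emeasure_PiM_vec_cylinder[of "{..<l}" i "part_box l i - K" "unit_part l"]
    have X: "part_box l i - K \<in> sets borel"
      using K by simp
    show "bad i \<in> sets ?P"
      unfolding bad_eq[OF that] using I(2,3)[OF that] X by (intro cyl(2)) auto
    have "card ({..<l} - range i) = l - ?d"
      using I(2,3)[OF that] by (subst card_Diff_subset) (auto simp: card_image)
    then have "(\<Prod>s\<in>{..<l} - range i. emeasure lborel (unit_part l s)) = ennreal ((1 / real l) ^ (l - ?d))"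
      using l0 by (simp add: emeasure_part ennreal_power)
    moreover have "emeasure ?P (bad i) =
      emeasure lborel (part_box l i - K) * (\<Prod>s\<in>{..<l} - range i. emeasure lborel (unit_part l s))"
      unfolding bad_eq[OF that] using I(2,3)[OF that] X by (intro cyl(1)) auto
    ultimately show "emeasure ?P (bad i) = emeasure lborel (part_box l i - K) * ennreal ((1 / real l) ^ (l - ?d))"
      by simp
  qed
  define \<theta> where "\<theta> = 2 * \<eta> * real l ^ ?d"
  define nb where "nb z = (\<Sum>i\<in>I. indicat_real (bad i) z)" for z
  have nb_meas: "nb \<in> borel_measurable ?P"
    unfolding nb_def using bad(1) by (intro borel_measurable_sum borel_measurable_indicator) auto
  have nb_card: "nb z = real (card {i \<in> I. (\<chi> j. z (i j)) \<notin> K})" if "z \<in> P0" for z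
  proof -
    have "nb z = (\<Sum>i\<in>I. if (\<chi> j. z (i j)) \<notin> K then 1 else 0)"
      unfolding nb_def using that by (intro sum.cong) (auto simp: bad_def indicator_def)
    then show ?thesis
      using I(1) by (simp add: sum.If_cases Int_def)
  qed
  define WW where "WW = (\<Union>i\<in>I. {z \<in> space ?P. (\<chi> j. z (i j)) \<in> W})"
  have WW: "WW \<in> null_sets ?P"
    unfolding WW_def using I W by (intro null_sets.finite_UN null_sets_PiM_vec) auto
  define E where "E = {z \<in> P0. nb z \<le> \<theta>} - WW"
  have E_sets: "E \<in> sets ?P"
  proof -
    have "{z \<in> P0. nb z \<le> \<theta>} = P0 \<inter> {z \<in> space ?P. nb z \<le> \<theta>}"
      using sets.sets_into_space[OF P0] by auto
    also have "\<dots> \<in> sets ?P"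
      using P0 nb_meas by (intro sets.Int borel_measurable_le) auto
    finally show ?thesis
      unfolding E_def using WW by auto
  qed
  have "emeasure ?P E \<noteq> 0"
  proof
    assume "emeasure ?P E = 0"
    then have "E \<union> WW \<in> null_sets ?P"
      using E_sets WW by auto
    then have "AE z in ?P. z \<notin> E \<union> WW"
      by (rule AE_not_in)
    \<comment> \<open>Were \<open>E\<close> null, almost every sample in \<open>P0\<close> would
      have more than \<open>\<theta>\<close> bad cells; integrating this pointwise bound contradicts
      the bound on the expectation.\<close>
    then have "AE z in ?P. ennreal \<theta> * indicator P0 z \<le> (\<Sum>i\<in>I. indicator (bad i) z)"
    proof eventually_elim
      case (elim z)
      show ?case
      proof (cases "z \<in> P0")
        case True
        then have "\<theta> \<le> nb z"
          using elim by (auto simp: E_def)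
        then have "ennreal \<theta> \<le> ennreal (nb z)"
          by (rule ennreal_leI)
        also have "ennreal (nb z) = (\<Sum>i\<in>I. ennreal (indicat_real (bad i) z))"
          unfolding nb_def by (rule sum_ennreal[symmetric]) simp
        also have "\<dots> = (\<Sum>i\<in>I. indicator (bad i) z)"
          by (intro sum.cong) (auto simp: indicator_def)
        finally show ?thesis
          using True by simp
      qed simp
    qed
    then have "(\<integral>\<^sup>+z. ennreal \<theta> * indicator P0 z \<partial>?P) \<le> (\<integral>\<^sup>+z. (\<Sum>i\<in>I. indicator (bad i) z) \<partial>?P)"
      by (rule nn_integral_mono_AE)
    also have "\<dots> = (\<Sum>i\<in>I. emeasure ?P (bad i))"
      using bad(1) by (subst nn_integral_sum) auto
    also have "\<dots> = (\<Sum>i\<in>I. emeasure lborel (part_box l i - K)) * ennreal ((1 / real l) ^ (l - ?d))"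
      using bad(2) by (simp add: sum_distrib_right)
    also have "(\<Sum>i\<in>I. emeasure lborel (part_box l i - K)) = emeasure lborel (\<Union>i\<in>I. part_box l i - K)"
    proof (rule sum_emeasure)
      show "disjoint_family_on (\<lambda>i. part_box l i - K) I"
        using disjoint_part_boxes[OF l0, of I] unfolding disjoint_family_on_def by blast
    qed (use K I in auto)
    also have "\<dots> \<le> emeasure lborel (unit_cube - K)"
      using part_box_subset_unit_cube[OF I(3)] K(1)
      by (intro emeasure_mono UN_least Diff_mono) simp_all
    also have "\<dots> \<le> ennreal \<eta>"
      by (rule K)
    finally have "ennreal \<theta> * ennreal ((1 / real l) ^ l) \<le> ennreal \<eta> * ennreal ((1 / real l) ^ (l - ?d))"
      using P0 P0_eq by (simp add: nn_integral_cmult_indicator mult_right_mono)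
    then have "\<theta> * (1 / real l) ^ l \<le> \<eta> * (1 / real l) ^ (l - ?d)"
      using \<eta> l0 by (simp add: ennreal_mult[symmetric] \<theta>_def)
    moreover have "(1 / real l) ^ l = (1 / real l) ^ (l - ?d) * (1 / real l) ^ ?d"
      using l by (simp add: power_add[symmetric])
    then have "\<theta> * (1 / real l) ^ l = 2 * \<eta> * (1 / real l) ^ (l - ?d)"
      using l0 by (simp add: \<theta>_def power_one_over field_simps)
    moreover have "\<eta> * (1 / real l) ^ (l - ?d) > 0"
      using \<eta> l0 by simp
    ultimately show False
      by linarith
  qed
  then show thesis
  proof (rule that[OF E_sets])
    fix z assume z: "z \<in> E"
    then have zP: "z \<in> P0"
      by (simp add: E_def)
    show "z s \<in> unit_part l s" if "s < l" for s
      using zP that by (auto simp: P0_def)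
    show "(\<chi> j. z (i j)) \<notin> W" if "i \<in> cell_tuples l" for i
      using z sets.sets_into_space[OF P0] that by (auto simp: E_def WW_def I_def)
    show "real (card {i \<in> cell_tuples l. (\<chi> j. z (i j)) \<notin> K}) \<le> 2 * \<eta> * real l ^ CARD('d)"
      using z nb_card[OF zP] by (simp add: E_def \<theta>_def I_def)
  qed
qed

lemma part_index_le_iff:
  assumes "l > 0" "t \<in> {0<..1}" "t' \<in> {0<..1}" "part_index l t \<noteq> part_index l t'"
  shows "t \<le> t' \<longleftrightarrow> part_index l t \<le> part_index l t'"
  using part_less[OF _ in_part_part_index(1)[OF assms(1,2)] in_part_part_index(1)[OF assms(1,3)]]
    part_less[OF _ in_part_part_index(1)[OF assms(1,3)] in_part_part_index(1)[OF assms(1,2)]] assms(4)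
  by (meson linorder_not_le nle_le order_less_imp_le)

text \<open>\<open>C\<close> is found by pigeonhole: only finitely many colourings of the
  off-diagonal cells can be induced by samples, so one of them is induced on a set of positive
  measure. For the distance, compare with one sample \<open>z\<close> inducing \<open>C\<close>: a
  point of \<open>K\<close> lies in an off-diagonal cell, since its coordinates are more than
  \<open>1 / real l\<close> apart, and it has the colour of the vector of \<open>z\<close> in that
  cell as soon as this vector is in \<open>K\<close>.\<close>

lemma typical_cell_pattern:
  fixes F :: "real ^ 'd \<Rightarrow> nat"
  assumes F: "measurable_colouring k F" and \<epsilon>: "\<epsilon> > 0"
  obtains l E C where "l > 0" "E \<in> sets (PiM {..<l} (\<lambda>_. lborel))" "emeasure (PiM {..<l} (\<lambda>_. lborel)) E \<noteq> 0"
    "\<forall>z\<in>E. \<forall>s<l. z s \<in> unit_part l s"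
    "\<forall>z\<in>E. \<forall>i\<in>cell_tuples l. F (\<chi> j. z (i j)) = C i"
    "\<forall>G. (\<forall>y\<in>unit_cube. (\<lambda>j. part_index l (y $ j)) \<in> cell_tuples l \<longrightarrow>
        G y = C (\<lambda>j. part_index l (y $ j))) \<longrightarrow> colouring_dist F G \<le> \<epsilon>"
proof -
  \<comment> \<open>One third pays for the points outside \<open>K\<close>, two thirds for the cells
    in which the sample misses \<open>K\<close>.\<close>
  define \<eta> where "\<eta> = \<epsilon> / 3"
  have \<eta>: "\<eta> > 0"
    using \<epsilon> by (simp add: \<eta>_def)
  obtain K \<delta> where K: "compact K" "K \<subseteq> unit_cube" "emeasure lborel (unit_cube - K) \<le> ennreal \<eta>"
    and \<delta>: "\<delta> > 0" "\<And>x y. x \<in> K \<Longrightarrow> y \<in> K \<Longrightarrow> (\<And>j. \<bar>x $ j - y $ j\<bar> < \<delta>) \<Longrightarrow> F x = F y"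
      "\<And>x j j'. x \<in> K \<Longrightarrow> j \<noteq> j' \<Longrightarrow> \<delta> \<le> \<bar>x $ j - x $ j'\<bar>"
    using compact_core[OF F \<eta>] by blast
  obtain B W where B: "\<And>c. c \<in> {1..k} \<Longrightarrow> B c \<in> sets borel" "\<And>c x. c \<in> {1..k} \<Longrightarrow> x \<in> B c \<Longrightarrow> F x = c"
    and W: "W \<in> null_sets lborel" "unit_cube \<subseteq> W \<union> (\<Union>c\<in>{1..k}. B c)"
    using borel_colour_classes[OF F] by blast
  have Kb: "K \<in> sets borel"
    using K(1) by (simp add: borel_compact)
  obtain m :: nat where m: "1 / \<delta> < real m"
    using reals_Archimedean2 by blast
  \<comment> \<open>\<open>m\<close> makes the parts shorter than \<open>\<delta>\<close>; the
    dimension is added to guarantee \<open>l \<ge> CARD('d)\<close>.\<close>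
  define l where "l = m + CARD('d)"
  have l: "l \<ge> CARD('d)" "l > 0"
    by (simp_all add: l_def)
  have l\<delta>: "1 / real l < \<delta>"
  proof -
    have "1 / \<delta> < real l"
      using m by (simp add: l_def)
    then show ?thesis
      using \<delta>(1) l(2) by (simp add: field_simps)
  qed
  let ?P = "PiM {..<l} (\<lambda>_. lborel :: real measure)"
  let ?I = "cell_tuples l :: ('d \<Rightarrow> nat) set"
  obtain E where E: "E \<in> sets ?P" "emeasure ?P E \<noteq> 0"
    "\<And>z s. z \<in> E \<Longrightarrow> s < l \<Longrightarrow> z s \<in> unit_part l s"
    "\<And>z i. z \<in> E \<Longrightarrow> i \<in> ?I \<Longrightarrow> (\<chi> j. z (i j)) \<notin> W"
    "\<And>z. z \<in> E \<Longrightarrow> real (card {i \<in> ?I. (\<chi> j. z (i j)) \<notin> K}) \<le> 2 * \<eta> * real l ^ CARD('d)"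
    using few_bad_cells_not_null[OF l(1) Kb K(3) \<eta> W(1)] by blast
  have box: "(\<chi> j. z (i j)) \<in> part_box l i" if "z \<in> E" "i \<in> ?I" for z i
    using E(3)[OF that(1)] that(2) by (auto simp: part_box_def cell_tuples_def)
  \<comment> \<open>Membership in the Borel sets \<open>B\<close>, rather than the value of
    \<open>F\<close>, keeps these events measurable.\<close>
  define EC where "EC C = {z \<in> E. \<forall>i\<in>?I. (\<chi> j. z (i j)) \<in> B (C i)}" for C
  have EC_sets: "EC C \<in> sets ?P" if C: "C \<in> ?I \<rightarrow>\<^sub>E {1..k}" for C
  proof -
    have "{z \<in> space ?P. (\<chi> j. z (i j)) \<in> B (C i)} \<in> sets ?P" if "i \<in> ?I" for i
    proof -
      have "C i \<in> {1..k}"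
        using C that by auto
      then show ?thesis
        using emeasure_PiM_vec_cylinder(2)[of "{..<l}" i "B (C i)" "\<lambda>_. UNIV"] B(1) that
        by (simp add: cell_tuples_def)
    qed
    then have "{z \<in> space ?P. \<forall>i\<in>?I. (\<chi> j. z (i j)) \<in> B (C i)} \<in> sets ?P"
      using finite_cell_tuples by (intro sets.sets_Collect_finite_All) auto
    moreover have "EC C = E \<inter> {z \<in> space ?P. \<forall>i\<in>?I. (\<chi> j. z (i j)) \<in> B (C i)}"
      using sets.sets_into_space[OF E(1)] by (auto simp: EC_def)
    ultimately show ?thesis
      using E(1) by auto
  qed
  have "\<exists>C \<in> ?I \<rightarrow>\<^sub>E {1..k}. emeasure ?P (EC C) \<noteq> 0"
  proof (rule ccontr)
    assume "\<not> ?thesis"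
    then have "(\<Union>C \<in> ?I \<rightarrow>\<^sub>E {1..k}. EC C) \<in> null_sets ?P"
      using EC_sets finite_cell_tuples by (intro null_sets.finite_UN) (auto intro: finite_PiE)
    moreover have "E \<subseteq> (\<Union>C \<in> ?I \<rightarrow>\<^sub>E {1..k}. EC C)"
    proof
      fix z assume z: "z \<in> E"
      define C where "C = (\<lambda>i\<in>?I. F (\<chi> j. z (i j)))"
      have "C i \<in> {1..k} \<and> (\<chi> j. z (i j)) \<in> B (C i)" if i: "i \<in> ?I" for i
      proof -
        have "(\<chi> j. z (i j)) \<in> unit_cube"
          using box[OF z i] part_box_subset_unit_cube[of i l] i by (auto simp: cell_tuples_def)
        then obtain c where "c \<in> {1..k}" "(\<chi> j. z (i j)) \<in> B c"
          using W(2) E(4)[OF z i] by blast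
        then show ?thesis
          using B(2) i by (simp add: C_def)
      qed
      then have "z \<in> EC C" "C \<in> ?I \<rightarrow>\<^sub>E {1..k}"
        using z by (auto simp: EC_def C_def)
      then show "z \<in> (\<Union>C \<in> ?I \<rightarrow>\<^sub>E {1..k}. EC C)"
        by blast
    qed
    ultimately have "E \<in> null_sets ?P"
      using E(1) null_sets_subset by blast
    then show False
      using E(2) by auto
  qed
  then obtain C where C: "C \<in> ?I \<rightarrow>\<^sub>E {1..k}" "emeasure ?P (EC C) \<noteq> 0"
    by blast
  have FC: "F (\<chi> j. z (i j)) = C i" if "z \<in> EC C" "i \<in> ?I" for z i
  proof -
    have "C i \<in> {1..k}"
      using C(1) that(2) by auto
    then show ?thesis
      using that by (intro B(2)) (auto simp: EC_def)
  qed
  obtain z where z: "z \<in> EC C"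
    using C(2) by fastforce
  then have zE: "z \<in> E"
    by (simp add: EC_def)
  show thesis
  proof (rule that[OF l(2) EC_sets[OF C(1)] C(2)]; intro ballI allI impI)
    show "z s \<in> unit_part l s" if "z \<in> EC C" "s < l" for z s
      using that E(3) by (simp add: EC_def)
    show "F (\<chi> j. z (i j)) = C i" if "z \<in> EC C" "i \<in> ?I" for z i
      using that by (rule FC)
    fix G :: "real ^ 'd \<Rightarrow> nat"
    assume G: "\<forall>y\<in>unit_cube. (\<lambda>j. part_index l (y $ j)) \<in> ?I \<longrightarrow>
        G y = C (\<lambda>j. part_index l (y $ j))"
    define I' where "I' = {i \<in> ?I. (\<chi> j. z (i j)) \<notin> K}"
    have finI': "finite I'"
      by (simp add: I'_def finite_cell_tuples)
    define U where "U = (unit_cube - K) \<union> (\<Union>i\<in>I'. part_box l i)"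
    have "measure lebesgue {y \<in> unit_cube. F y \<noteq> G y} \<le> \<epsilon>"
    proof (rule measure_lebesgue_le)
      show "{y \<in> unit_cube. F y \<noteq> G y} \<subseteq> U"
      proof
        fix y assume y: "y \<in> {y \<in> unit_cube. F y \<noteq> G y}"
        show "y \<in> U"
        proof (cases "y \<in> K")
          case True
          define i where "i = (\<lambda>j. part_index l (y $ j))"
          have yi: "y $ j \<in> unit_part l (i j)" "i j < l" for j
            using y in_part_part_index[OF l(2), of "y $ j"] by (auto simp: unit_cube_def i_def)
          have "inj i"
          proof (rule injI, rule ccontr)
            fix j j' assume "i j = i j'" "j \<noteq> j'"
            then have "\<bar>y $ j - y $ j'\<bar> < 1 / real l"
              using yi part_diff_less[OF l(2)] by metis
            then show False
              using \<delta>(3)[OF True \<open>j \<noteq> j'\<close>] l\<delta> by linarith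
          qed
          then have i: "i \<in> ?I"
            using yi by (auto simp: cell_tuples_def)
          have "(\<chi> j. z (i j)) \<notin> K"
          proof
            assume zK: "(\<chi> j. z (i j)) \<in> K"
            have "F y = F (\<chi> j. z (i j))"
            proof (rule \<delta>(2)[OF True zK])
              fix j
              have "\<bar>y $ j - z (i j)\<bar> < 1 / real l"
                using part_diff_less[OF l(2) yi(1)] E(3)[OF zE yi(2)] by blast
              then show "\<bar>y $ j - (\<chi> j. z (i j)) $ j\<bar> < \<delta>"
                using l\<delta> by simp
            qed
            also have "\<dots> = G y"
              using FC[OF z i] G y i by (simp add: i_def)
            finally show False
              using y by simp
          qed
          then show ?thesis
            using i yi by (auto simp: U_def I'_def part_box_def)
        qed (use y in \<open>auto simp: U_def\<close>)
      qed
      show "U \<in> sets borel"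
        unfolding U_def using Kb finI' by auto
      have "emeasure lborel U \<le> emeasure lborel (unit_cube - K) + emeasure lborel (\<Union>i\<in>I'. part_box l i)"
        unfolding U_def using Kb finI' by (intro emeasure_subadditive) auto
      also have "\<dots> \<le> ennreal \<eta> + (\<Sum>i\<in>I'. emeasure lborel (part_box l i :: (real ^ 'd) set))"
        using K(3) finI' by (intro add_mono emeasure_subadditive_finite) auto
      also have "(\<Sum>i\<in>I'. emeasure lborel (part_box l i :: (real ^ 'd) set)) =
          ennreal (real (card I') * (1 / real l) ^ CARD('d))"
        using l(2) by (simp add: emeasure_part_box ennreal_mult' ennreal_of_nat_eq_real_of_nat)
      also have "\<dots> \<le> ennreal (2 * \<eta> * real l ^ CARD('d) * (1 / real l) ^ CARD('d))"
        using E(5)[OF zE] by (intro ennreal_leI mult_right_mono) (auto simp: I'_def)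
      also have "2 * \<eta> * real l ^ CARD('d) * (1 / real l) ^ CARD('d) = 2 * \<eta>"
        using l(2) by (simp add: power_one_over)
      also have "ennreal \<eta> + ennreal (2 * \<eta>) = ennreal \<epsilon>"
        using \<eta> by (simp add: \<eta>_def flip: ennreal_plus)
      finally show "emeasure lborel U \<le> ennreal \<epsilon>"
        by (simp add: add_left_mono)
    qed (use \<epsilon> in simp)
    then show "colouring_dist F G \<le> \<epsilon>"
      by (simp add: colouring_dist_def)
  qed
qed

section \<open>The homogeneous colouring\<close>

text \<open>Outer measure zero is attained by a measurable superset. Conditioning on
  \<open>ordered_points n\<close> divides by a finite number, so the part of this superset inside
  \<open>ordered_points n\<close> is null for the product measure.\<close>

lemma not_positive_prob_null:
  assumes "\<not> appears_with_positive_prob n R F"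
  obtains Z where "Z \<in> null_sets (PiM {1..n} (\<lambda>_. lborel))" "{x \<in> ordered_points n. realizes F n R x} \<subseteq> Z"
proof -
  let ?M = "PiM {1..n} (\<lambda>_. lborel :: real measure)"
  let ?S = "{x \<in> ordered_points n. realizes F n R x}"
  have op: "ordered_points n \<in> sets ?M"
    by (rule ordered_points_measurable)
  have "?S \<subseteq> space (uniform_ordered_points n)"
    using sets.sets_into_space[OF op] by (auto simp: uniform_ordered_points_def)
  from outer_measure_of_attain[OF this] obtain Y where Y: "Y \<in> sets (uniform_ordered_points n)" "?S \<subseteq> Y"
    "emeasure (uniform_ordered_points n) Y = 0"
    using assms by (auto simp: appears_with_positive_prob_def statistic_prob_def)
  have Y': "Y \<in> sets ?M"
    using Y(1) by (simp add: uniform_ordered_points_def)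
  \<comment> \<open>Finiteness matters because in \<open>ennreal\<close> a quotient by
    \<open>top\<close> is \<open>0\<close> as well.\<close>
  have "emeasure ?M (ordered_points n) \<le> emeasure ?M (\<Pi>\<^sub>E i\<in>{1..n}. {0<..1})"
    by (intro emeasure_mono sets_PiM_I_finite) (auto simp: ordered_points_def)
  also have "\<dots> = (\<Prod>i\<in>{1..n}. emeasure lborel {0<..1::real})"
    by (intro product_sigma_finite.emeasure_PiM[OF product_sigma_finite_lborel]) auto
  finally have "emeasure ?M (ordered_points n) \<noteq> top"
    by (auto simp: top_unique)
  moreover have "emeasure ?M (ordered_points n \<inter> Y) / emeasure ?M (ordered_points n) = 0"
    using Y(3) Y' op by (simp add: uniform_ordered_points_def)
  ultimately have "emeasure ?M (ordered_points n \<inter> Y) = 0"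
    by (simp add: ennreal_divide_eq_0_iff)
  then have "ordered_points n \<inter> Y \<in> null_sets ?M"
    using op Y' by auto
  then show thesis
    using that Y(2) by blast
qed

lemma strictly_sorting_reindexing:
  fixes f :: "nat \<Rightarrow> 'a::linorder"
  assumes "inj_on f {..<N}"
  obtains \<pi> where "\<And>a. a < N \<Longrightarrow> \<pi> a < N" "strict_mono_on {..<N} (f \<circ> \<pi>)"
proof -
  define xs where "xs = sorted_list_of_set (f ` {..<N})"
  have len: "length xs = N" and set: "set xs = f ` {..<N}"
    using assms by (simp_all add: xs_def card_image)
  have "\<forall>a. \<exists>b. a < N \<longrightarrow> b < N \<and> xs ! a = f b"
    using set len by (metis imageE lessThan_iff nth_mem)
  then obtain \<pi> where \<pi>: "\<And>a. a < N \<Longrightarrow> \<pi> a < N \<and> xs ! a = f (\<pi> a)"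
    by metis
  have "xs ! a < xs ! b" if "a < b" "b < N" for a b
    using that len by (simp add: xs_def sorted_wrt_nth_less[OF strict_sorted_list_of_set])
  then have "strict_mono_on {..<N} (f \<circ> \<pi>)"
    using \<pi> by (auto simp: strict_mono_on_def)
  with \<pi> show thesis
    using that by blast
qed

text \<open>The order type and the cell are exactly the data on which a homogeneous colouring may
  depend. The order type comes first to match the function that the Ramsey theorem returns.\<close>

definition pattern_colouring :: "nat \<Rightarrow> (('d \<Rightarrow> nat) \<Rightarrow> ('d \<Rightarrow> nat) \<Rightarrow> nat) \<Rightarrow> real ^ 'd \<Rightarrow> nat" where
  "pattern_colouring l P y = P (dense_rank (\<lambda>j. y $ j)) (\<lambda>j. part_index l (y $ j))"

lemma part_homogeneous_pattern_colouring:
  fixes P :: "('d::finite \<Rightarrow> nat) \<Rightarrow> ('d \<Rightarrow> nat) \<Rightarrow> nat"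
  shows "part_homogeneous l (pattern_colouring l P)"
  unfolding part_homogeneous_def
proof (intro ballI impI)
  fix x y :: "real ^ 'd"
  assume xy: "(\<forall>j. \<lceil>real l * x $ j\<rceil> = \<lceil>real l * y $ j\<rceil>) \<and> (\<forall>j j'. (x $ j \<le> x $ j') = (y $ j \<le> y $ j'))"
  then have "dense_rank (\<lambda>j. x $ j) = dense_rank (\<lambda>j. y $ j)"
    by (intro dense_rank_cong) simp
  with xy show "pattern_colouring l P x = pattern_colouring l P y"
    by (simp add: pattern_colouring_def part_index_def)
qed

text \<open>In an off-diagonal cell the order of the coordinates is the order of their parts. The
  cell then determines the order type, which is what lets \<open>C\<close> prescribe a pattern
  there.\<close>

lemma dense_rank_part_index:
  assumes l: "l > 0" and y: "y \<in> unit_cube" and inj: "inj (\<lambda>j. part_index l (y $ j))"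
  shows "dense_rank (\<lambda>j. y $ j) = dense_rank (\<lambda>j. part_index l (y $ j))"
proof (rule dense_rank_cong)
  fix j j'
  show "y $ j \<le> y $ j' \<longleftrightarrow> part_index l (y $ j) \<le> part_index l (y $ j')"
  proof (cases "j = j'")
    case False
    then have "part_index l (y $ j) \<noteq> part_index l (y $ j')"
      using inj by (auto dest: injD)
    then show ?thesis
      using l y by (intro part_index_le_iff) (auto simp: unit_cube_def)
  qed simp
qed

theorem theorem11:
  fixes F :: "real ^ 'd \<Rightarrow> nat" and k :: nat and \<epsilon> :: real
  assumes "k > 0"
    and "measurable_colouring k F"
    and "\<epsilon> > 0"
  shows "\<exists>l>0. \<exists>G :: real ^ 'd \<Rightarrow> nat.
    G \<in> unit_cube \<rightarrow> {1..k} \<and> part_homogeneous l G \<and> colouring_dist F G \<le> \<epsilon> \<and>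
    (\<forall>n. \<forall>R \<in> grid n \<rightarrow> {1..k}. appears_in n R G \<longrightarrow> appears_with_positive_prob n R F)"
proof -
  obtain l E C where l: "l > 0" and E: "E \<in> sets (PiM {..<l} (\<lambda>_. lborel))"
      "emeasure (PiM {..<l} (\<lambda>_. lborel)) E \<noteq> 0"
      "\<forall>z\<in>E. \<forall>s<l. z s \<in> unit_part l s"
      "\<forall>z\<in>E. \<forall>i\<in>cell_tuples l. F (\<chi> j. z (i j)) = C i"
    and dist: "\<forall>G. (\<forall>y\<in>unit_cube. (\<lambda>j. part_index l (y $ j)) \<in> cell_tuples l \<longrightarrow>
        G y = C (\<lambda>j. part_index l (y $ j))) \<longrightarrow> colouring_dist F G \<le> \<epsilon>"
    by (rule typical_cell_pattern[OF assms(2,3)])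
  define bounded_tuples where "bounded_tuples m = {i :: 'd \<Rightarrow> nat. \<forall>j. i j < m}" for m
  have fin_bt: "finite (bounded_tuples m)" for m
  proof -
    have "bounded_tuples m = UNIV \<rightarrow>\<^sub>E {..<m}"
      by (auto simp: bounded_tuples_def)
    then show ?thesis
      by (simp add: finite_PiE)
  qed
  define colours where "colours = bounded_tuples l \<rightarrow>\<^sub>E {1..k}"
  have fin_colours: "finite colours"
    unfolding colours_def using fin_bt by (intro finite_PiE) auto
  \<comment> \<open>Extensional functions keep this set finite; agreement with \<open>C\<close> on
    off-diagonal cells will give the distance bound.\<close>
  define patterns where
    "patterns = {P \<in> bounded_tuples CARD('d) \<rightarrow>\<^sub>E colours. \<forall>i\<in>cell_tuples l. P (dense_rank i) i = C i}"
  have fin_patterns: "finite patterns"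
  proof -
    have "finite (bounded_tuples CARD('d) \<rightarrow>\<^sub>E colours)"
      using fin_bt fin_colours by (intro finite_PiE) auto
    then show ?thesis
      by (simp add: patterns_def)
  qed
  have rank_bt: "dense_rank t \<in> bounded_tuples CARD('d)" for t :: "'d \<Rightarrow> 'a::linorder"
    using dense_rank_less_CARD by (auto simp: bounded_tuples_def)
  have index_bt: "(\<lambda>j. part_index l (y $ j)) \<in> bounded_tuples l" if "y \<in> unit_cube" for y :: "real ^ 'd"
    using that in_part_part_index(2)[OF l] by (auto simp: bounded_tuples_def unit_cube_def)
  \<comment> \<open>Otherwise each of the finitely many patterns has an \<open>R\<close> that
    appears in its colouring but in \<open>F\<close> only on a null set. A sample avoiding these
    null sets yields, by Ramsey, a pattern whose own \<open>R\<close> is realised by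
    \<open>F\<close> on sampled points.\<close>
  have "\<exists>P\<in>patterns. \<forall>n R. appears_in n R (pattern_colouring l P) \<longrightarrow> appears_with_positive_prob n R F"
  proof (rule ccontr)
    assume "\<not> ?thesis"
    then obtain n R where bad: "\<And>P. P \<in> patterns \<Longrightarrow> appears_in (n P) (R P) (pattern_colouring l P)"
      "\<And>P. P \<in> patterns \<Longrightarrow> \<not> appears_with_positive_prob (n P) (R P) F"
      by metis
    have "\<forall>P. \<exists>Z. P \<in> patterns \<longrightarrow> Z \<in> null_sets (PiM {1..n P} (\<lambda>_. lborel)) \<and>
        {x \<in> ordered_points (n P). realizes F (n P) (R P) x} \<subseteq> Z"
      using not_positive_prob_null[OF bad(2)] by metis
    then obtain Z where Z: "\<And>P. P \<in> patterns \<Longrightarrow> Z P \<in> null_sets (PiM {1..n P} (\<lambda>_. lborel))"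
      "\<And>P. P \<in> patterns \<Longrightarrow> {x \<in> ordered_points (n P). realizes F (n P) (R P) x} \<subseteq> Z P"
      by metis
    \<comment> \<open>The sum accommodates the \<open>n P\<close> points of every pattern; the
      summand \<open>l\<close> lets cell tuples serve as position tuples when the pattern is
      compared with \<open>C\<close>.\<close>
    define m where "m = l + (\<Sum>P\<in>patterns. n P)"
    have nm: "n P \<le> m" if "P \<in> patterns" for P
      using member_le_sum[OF that, of n] fin_patterns by (simp add: m_def)
    obtain N where N: "\<And>\<Phi> :: ('d \<Rightarrow> nat) \<Rightarrow> ('d \<Rightarrow> nat) \<Rightarrow> nat. (\<And>a. (\<forall>j. a j < N) \<Longrightarrow> \<Phi> a \<in> colours) \<Longrightarrow>
      \<exists>h P. strict_mono_on {..m} h \<and> h ` {..m} \<subseteq> {..<N} \<and>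
        (\<forall>\<rho>. (\<forall>j. \<rho> j < CARD('d)) \<longrightarrow> P \<rho> \<in> colours) \<and>
        (\<forall>t. (\<forall>j. t j \<le> m) \<longrightarrow> \<Phi> (h \<circ> t) = P (dense_rank t))"
      using order_type_ramsey[OF fin_colours] by blast
    \<comment> \<open>Applied to a constant map, the Ramsey property produces elements below
      \<open>N\<close>.\<close>
    have "N > 0"
    proof -
      have "(\<lambda>i\<in>bounded_tuples l. 1) \<in> colours"
        using \<open>k > 0\<close> by (auto simp: colours_def)
      then obtain h where "h ` {..m} \<subseteq> {..<N}"
        using N[of "\<lambda>_. \<lambda>i\<in>bounded_tuples l. 1"] by blast
      then show ?thesis
        by (metis atMost_iff gr0I image_subset_iff lessThan_iff less_nat_zero_code zero_le)
    qed
    define L where "L = {..<l} \<times> {..<N}"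
    let ?M = "PiM L (\<lambda>_. lborel :: real measure)"
    have finL: "finite L"
      by (simp add: L_def)
    obtain A where A: "A \<in> sets ?M" "emeasure ?M A \<noteq> 0"
      "\<And>x a. x \<in> A \<Longrightarrow> (\<And>i. a i < N) \<Longrightarrow> (\<lambda>i\<in>{..<l}. x (i, a i)) \<in> E"
      using blow_up_not_null[OF E(1,2) \<open>N > 0\<close>] unfolding L_def by blast
    define ties where "ties = (\<Union>p\<in>L. \<Union>q\<in>L - {p}. {x \<in> space ?M. x p = x q})"
    have ties: "ties \<in> null_sets ?M"
      unfolding ties_def using finL by (intro null_sets.finite_UN ties_null) auto
    \<comment> \<open>All injective placements of the \<open>n P\<close> points among the sampled
      coordinates are included, as it is not known in advance which of them will realise
      \<open>R P\<close>.\<close>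
    define rare where "rare = (\<Union>P\<in>patterns. \<Union>\<sigma>\<in>{\<sigma> \<in> {1..n P} \<rightarrow>\<^sub>E L. inj_on \<sigma> {1..n P}}.
      {x \<in> space ?M. (\<lambda>t\<in>{1..n P}. x (\<sigma> t)) \<in> Z P})"
    have rare: "rare \<in> null_sets ?M"
      unfolding rare_def
    proof (intro null_sets.finite_UN null_sets_PiM_reindex_lborel)
      show "finite {\<sigma> \<in> {1..n P} \<rightarrow>\<^sub>E L. inj_on \<sigma> {1..n P}}" for P
        using finL by (simp add: finite_PiE)
    qed (use Z(1) finL fin_patterns in auto)
    have "\<not> A \<subseteq> ties \<union> rare"
    proof
      assume "A \<subseteq> ties \<union> rare"
      then have "A \<in> null_sets ?M"
        using A(1) null_sets.Un[OF ties rare] null_sets_subset by blast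
      then show False
        using A(2) by auto
    qed
    then obtain x where x: "x \<in> A" "x \<notin> ties" "x \<notin> rare"
      by blast
    have xM: "x \<in> space ?M"
      using x(1) sets.sets_into_space[OF A(1)] by blast
    have "\<exists>\<pi>. (\<forall>a<N. \<pi> a < N) \<and> strict_mono_on {..<N} ((\<lambda>a. x (s, a)) \<circ> \<pi>)" if "s < l" for s
    proof -
      have "inj_on (\<lambda>a. x (s, a)) {..<N}"
        using x(2) xM that by (intro inj_onI) (auto simp: ties_def L_def)
      then show ?thesis
        by (rule strictly_sorting_reindexing) blast
    qed
    then obtain \<pi> where \<pi>: "\<And>s a. s < l \<Longrightarrow> a < N \<Longrightarrow> \<pi> s a < N"
      "\<And>s. s < l \<Longrightarrow> strict_mono_on {..<N} ((\<lambda>a. x (s, a)) \<circ> \<pi> s)"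
      by metis
    \<comment> \<open>The points of part \<open>s\<close> in increasing order; the order is strict
      because \<open>x\<close> avoids ties.\<close>
    define w where "w s a = x (s, \<pi> s a)" for s a
    have w_mono: "w s a < w s b" if "s < l" "a < b" "b < N" for s a b
      using \<pi>(2)[OF that(1)] that(2,3) by (auto simp: strict_mono_on_def w_def)
    have w_E: "\<exists>z\<in>E. \<forall>s<l. z s = w s (a s)" if a: "\<And>s. s < l \<Longrightarrow> a s < N" for a
    proof -
      \<comment> \<open>The default \<open>0\<close> only meets the demand of \<open>A(3)\<close>
        that every index be below \<open>N\<close>.\<close>
      have "(\<lambda>s\<in>{..<l}. x (s, if s < l then \<pi> s (a s) else 0)) \<in> E"
        using x(1) \<pi>(1) a \<open>N > 0\<close> by (intro A(3)) auto
      then show ?thesis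
        by (rule bexI[rotated]) (auto simp: w_def)
    qed
    have w_part: "w s a \<in> unit_part l s" if "s < l" "a < N" for s a
      using w_E[of "\<lambda>_. a"] E(3) that by metis
    have w_cube: "(\<chi> j. w (i j) (a j)) \<in> unit_cube" if "i \<in> bounded_tuples l" "\<And>j. a j < N" for i a
    proof -
      have "w (i j) (a j) \<in> {0<..1}" for j
      proof -
        have "i j < l"
          using that(1) by (simp add: bounded_tuples_def)
        then show ?thesis
          using w_part[OF _ that(2)] part_subset_unit by blast
      qed
      then show ?thesis
        by (simp add: unit_cube_def)
    qed
    \<comment> \<open>A tuple \<open>a\<close> of positions is coloured by the colours of the
      corresponding points in all cells at once, including cells with repeated parts, so that one
      choice \<open>h\<close> of positions serves every cell. Since \<open>F\<close> is evaluated
      only at points of the fixed sample, its behaviour on diagonals raises no measurability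
      question.\<close>
    define \<Phi> where "\<Phi> a = (\<lambda>i\<in>bounded_tuples l. F (\<chi> j. w (i j) (a j)))" for a
    have \<Phi>: "\<Phi> a \<in> colours" if "\<forall>j. a j < N" for a
    proof -
      have "F (\<chi> j. w (i j) (a j)) \<in> {1..k}" if "i \<in> bounded_tuples l" for i
        using w_cube[OF that] \<open>\<forall>j. a j < N\<close> assms(2) by (auto simp: measurable_colouring_def)
      then show ?thesis
        by (simp add: \<Phi>_def colours_def)
    qed
    obtain h P0 where h: "strict_mono_on {..m} h" "h ` {..m} \<subseteq> {..<N}"
      and P0: "\<And>\<rho>. (\<forall>j. \<rho> j < CARD('d)) \<Longrightarrow> P0 \<rho> \<in> colours"
        "\<And>t. (\<forall>j. t j \<le> m) \<Longrightarrow> \<Phi> (h \<circ> t) = P0 (dense_rank t)"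
      using N[of \<Phi>, OF \<Phi>] by blast
    have hN: "h a < N" if "a \<le> m" for a
      using h(2) that by auto
    define P where "P = restrict P0 (bounded_tuples CARD('d))"
    have P_eq: "P (dense_rank t) i = F (\<chi> j. w (i j) (h (t j)))" if "\<And>j. t j \<le> m" "i \<in> bounded_tuples l" for t i
      using P0(2)[of t, symmetric] that rank_bt[of t] by (simp add: P_def \<Phi>_def)
    have P: "P \<in> patterns"
      unfolding patterns_def
    proof (intro CollectI conjI ballI)
      show "P \<in> bounded_tuples CARD('d) \<rightarrow>\<^sub>E colours"
        using P0(1) by (auto simp: P_def bounded_tuples_def)
      \<comment> \<open>The cell tuple \<open>i\<close> is used as its own tuple of positions. The
        point taken in part \<open>s\<close> is then the one at position \<open>h s\<close>, which
        depends on \<open>s\<close> alone, so these points come from one transversal and membership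
        in \<open>E\<close> gives the colour \<open>C i\<close>.\<close>
      fix i :: "'d \<Rightarrow> nat" assume i: "i \<in> cell_tuples l"
      then have il: "i j < l" for j
        by (auto simp: cell_tuples_def)
      have "h s < N" if "s < l" for s
        using that by (intro hN) (simp add: m_def)
      then obtain z where z: "z \<in> E" "\<And>s. s < l \<Longrightarrow> z s = w s (h s)"
        using w_E[of h] by blast
      have "P (dense_rank i) i = F (\<chi> j. w (i j) (h (i j)))"
        using il by (intro P_eq) (auto simp: m_def bounded_tuples_def intro: less_imp_le trans_le_add1)
      also have "\<dots> = F (\<chi> j. z (i j))"
        using z(2) il by simp
      finally show "P (dense_rank i) i = C i"
        using E(4) z(1) i by simp
    qed
    obtain y where y: "y \<in> ordered_points (n P)" "realizes (pattern_colouring l P) (n P) (R P) y"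
      using bad(1)[OF P] unfolding appears_in_def by blast
    have y_unit: "y t \<in> {0<..1}" if "t \<in> {1..n P}" for t
      using y(1) that by (auto simp: ordered_points_def)
    have y_mono: "strict_mono_on {1..n P} y"
      using y(1) by (simp add: ordered_points_def)
    define s where "s t = part_index l (y t)" for t
    have s: "s t < l" "y t \<in> unit_part l (s t)" if "t \<in> {1..n P}" for t
      using in_part_part_index[OF l y_unit[OF that]] by (simp_all add: s_def)
    have htN: "h t < N" if "t \<in> {1..n P}" for t
      using that nm[OF P] by (intro hN) simp
    \<comment> \<open>Each \<open>y t\<close> is replaced by the sampled point at position
      \<open>h t\<close> in the same part. Order is preserved: between parts automatically, within a
      part because \<open>h\<close> is increasing.\<close>
    define v where "v = (\<lambda>t\<in>{1..n P}. w (s t) (h t))"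
    have v_mono: "strict_mono_on {1..n P} v"
    proof (rule strict_mono_onI)
      fix t t' assume t: "t \<in> {1..n P}" "t' \<in> {1..n P}" "t < t'"
      then have "y t < y t'"
        using y_mono by (auto simp: strict_mono_on_def)
      then consider "s t = s t'" | "s t < s t'"
        using part_less[OF _ s(2)[OF t(2)] s(2)[OF t(1)]] by (meson linorder_neqE_nat not_less_iff_gr_or_eq)
      then have "w (s t) (h t) < w (s t') (h t')"
      proof cases
        case 1
        have "h t < h t'"
          using h(1) t nm[OF P] by (auto simp: strict_mono_on_def)
        then show ?thesis
          using 1 w_mono s(1) htN t by simp
      next
        case 2
        show ?thesis
          by (rule part_less[OF 2 w_part[OF s(1) htN] w_part[OF s(1) htN]]) (use t in simp_all)
      qed
      then show "v t < v t'"
        using t by (simp add: v_def)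
    qed
    have "v \<in> ordered_points (n P)"
    proof -
      have "v t \<in> {0<..1}" if "t \<in> {1..n P}" for t
        using w_part[OF s(1) htN, OF that that] part_subset_unit[OF s(1), OF that] that
        unfolding v_def by auto
      then show ?thesis
        using v_mono by (auto simp: ordered_points_def v_def)
    qed
    moreover have "realizes F (n P) (R P) v"
      unfolding realizes_def
    proof
      fix g :: "nat ^ 'd" assume g: "g \<in> grid (n P)"
      then have gj: "g $ j \<in> {1..n P}" for j
        by (simp add: grid_def)
      have gm: "g $ j \<le> m" for j
        using gj[of j] nm[OF P] by auto
      have "F (\<chi> j. v (g $ j)) = F (\<chi> j. w (s (g $ j)) (h (g $ j)))"
        using gj by (simp add: v_def)
      also have "\<dots> = P (dense_rank (\<lambda>j. g $ j)) (\<lambda>j. s (g $ j))"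
        using gm s(1)[OF gj] by (intro P_eq[symmetric]) (auto simp: bounded_tuples_def)
      \<comment> \<open>\<open>y\<close> is increasing, so an index tuple and the points it selects
        have the same order type, repetitions included.\<close>
      also have "dense_rank (\<lambda>j. g $ j) = dense_rank (\<lambda>j. y (g $ j))"
        using strict_mono_on_less_eq[OF y_mono] gj by (intro dense_rank_cong) simp
      also have "P (dense_rank (\<lambda>j. y (g $ j))) (\<lambda>j. s (g $ j)) = pattern_colouring l P (\<chi> j. y (g $ j))"
        by (simp add: pattern_colouring_def s_def)
      also have "\<dots> = R P g"
        using y(2) g by (simp add: realizes_def)
      finally show "F (\<chi> j. v (g $ j)) = R P g" .
    qed
    ultimately have "v \<in> Z P"
      using Z(2)[OF P] by blast
    \<comment> \<open>\<open>v\<close> consists of distinct coordinates of \<open>x\<close>, so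
      \<open>v \<in> Z P\<close> is one of the events collected in \<open>rare\<close>.\<close>
    define \<sigma> where "\<sigma> = (\<lambda>t\<in>{1..n P}. (s t, \<pi> (s t) (h t)))"
    have v_eq: "v = (\<lambda>t\<in>{1..n P}. x (\<sigma> t))"
      by (auto simp: v_def \<sigma>_def w_def)
    have "inj_on \<sigma> {1..n P}"
    proof (rule inj_onI)
      fix t t' assume t: "t \<in> {1..n P}" "t' \<in> {1..n P}" "\<sigma> t = \<sigma> t'"
      then have "v t = v t'"
        by (simp add: v_eq)
      then show "t = t'"
        using strict_mono_on_imp_inj_on[OF v_mono] t by (auto dest: inj_onD)
    qed
    moreover have "\<sigma> \<in> {1..n P} \<rightarrow>\<^sub>E L"
      using s(1) htN \<pi>(1) by (auto simp: \<sigma>_def L_def)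
    ultimately have "x \<in> rare"
      using P \<open>v \<in> Z P\<close> xM v_eq unfolding rare_def by blast
    with x(3) show False ..
  qed
  then obtain P where P: "P \<in> patterns"
    "\<And>n R. appears_in n R (pattern_colouring l P) \<Longrightarrow> appears_with_positive_prob n R F"
    by blast
  have "pattern_colouring l P \<in> unit_cube \<rightarrow> {1..k}"
  proof
    fix y :: "real ^ 'd" assume y: "y \<in> unit_cube"
    have "P \<in> bounded_tuples CARD('d) \<rightarrow>\<^sub>E colours"
      using P(1) by (simp add: patterns_def)
    then have "P (dense_rank (\<lambda>j. y $ j)) \<in> bounded_tuples l \<rightarrow>\<^sub>E {1..k}"
      unfolding colours_def using rank_bt by (rule PiE_mem)
    then show "pattern_colouring l P y \<in> {1..k}"
      unfolding pattern_colouring_def using index_bt[OF y] by (rule PiE_mem)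
  qed
  moreover have "colouring_dist F (pattern_colouring l P) \<le> \<epsilon>"
  proof (rule dist[rule_format])
    fix y :: "real ^ 'd"
    assume y: "y \<in> unit_cube" "(\<lambda>j. part_index l (y $ j)) \<in> cell_tuples l"
    then have "dense_rank (\<lambda>j. y $ j) = dense_rank (\<lambda>j. part_index l (y $ j))"
      using l by (intro dense_rank_part_index) (auto simp: cell_tuples_def)
    then show "pattern_colouring l P y = C (\<lambda>j. part_index l (y $ j))"
      using P(1) y(2) by (simp add: pattern_colouring_def patterns_def)
  qed
  ultimately show ?thesis
    by (intro exI[of _ l] exI[of _ "pattern_colouring l P"] conjI l
        part_homogeneous_pattern_colouring allI ballI impI P(2))
qed

end
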